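(* There exists a countable, finitely branching and acyclic MDP $\mathcal{M}$ with integer transition rewards and initial state $s_0$, whose step counter is implicit in the state, such that $s_0$ is almost surely winning for $\mathit{MP}_{\liminf\ge 0}=\{\rho\mid \liminf_{n\to\infty}\frac1n\sum_{j=0}^{n-1} r(e_j)\ge 0\}$, i.e., there is a strategy $\hat\sigma$ with $\mathcal{P}_{\mathcal{M},s_0,\hat\sigma}(\mathit{MP}_{\liminf\ge 0})=1$, but every finite-memory randomized (FR) strategy $\sigma$ satisfies $\mathcal{P}_{\mathcal{M},s_0,\sigma}(\mathit{MP}_{\liminf\ge 0})=0$. In particular, almost surely winning strategies for $\mathit{MP}_{\liminf\ge 0}$, when they exist, cannot in general be chosen $k$-bit Markov, for any $k\in\mathbb{N}$, in countable MDPs.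
   Context: An MDP has a countable set of states partitioned into controlled and random states, a transition relation (every state has a successor), fixed probability distributions over successors at random states, and real rewards on transitions; runs are $s_0e_0s_1e_1\dots$ with transitions $e_j$. It is finitely branching if each state has finitely many successors and acyclic if its transition graph has no directed cycle. The step counter is implicit in the state if for every state $s$ all finite paths from $s_0$ to $s$ have the same length. A strategy assigns to each finite partial run ending in a controlled state a distribution over successors, inducing a probability measure $\mathcal{P}_{\mathcal{M},s_0,\sigma}$ on runs. FR strategies are those implementable with a finite set of memory modes and (possibly randomized) memory updates and choices depending on the current mode and state. A $k$-bit Markov strategy bases its choices on the current state, the number of steps taken so far, and $k$ bits of general-purpose memory. *)

theory Defs
  imports "HOL-Probability.Probability"
begin

section \<open>Markov decision processes\<close>

text \<open>
  A transition is a pair of states, so a run \<open>s\<^sub>0 e\<^sub>0 s\<^sub>1 e\<^sub>1 \<dots>\<close> is determined by its sequence of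
  states: \<open>e\<^sub>j = (s\<^sub>j, s\<^sub>j\<^sub>+\<^sub>1)\<close>.
\<close>

record 's mdp =
  ctrl :: "'s set"
  rand :: "'s set"
  transitions :: "('s \<times> 's) set"
  succ_pmf :: "'s \<Rightarrow> 's pmf"
  reward :: "'s \<times> 's \<Rightarrow> real"

definition states :: "'s mdp \<Rightarrow> 's set" where
  "states M = ctrl M \<union> rand M"

definition succs :: "'s mdp \<Rightarrow> 's \<Rightarrow> 's set" where
  "succs M s = {s'. (s, s') \<in> transitions M}"

definition wf_mdp :: "'s mdp \<Rightarrow> bool" where
  "wf_mdp M \<longleftrightarrow>
     countable (states M) \<and>
     ctrl M \<inter> rand M = {} \<and>
     transitions M \<subseteq> states M \<times> states M \<and>
     (\<forall>s\<in>states M. succs M s \<noteq> {}) \<and>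
     (\<forall>s\<in>rand M. set_pmf (succ_pmf M s) \<subseteq> succs M s)"

definition finitely_branching :: "'s mdp \<Rightarrow> bool" where
  "finitely_branching M \<longleftrightarrow> (\<forall>s\<in>states M. finite (succs M s))"

definition integer_rewards :: "'s mdp \<Rightarrow> bool" where
  "integer_rewards M \<longleftrightarrow> (\<forall>e\<in>transitions M. reward M e \<in> \<int>)"

definition partial_run :: "'s mdp \<Rightarrow> 's list \<Rightarrow> bool" where
  "partial_run M h \<longleftrightarrow>
     h \<noteq> [] \<and> set h \<subseteq> states M \<and> (\<forall>i. Suc i < length h \<longrightarrow> (h ! i, h ! Suc i) \<in> transitions M)"

definition step_counter_implicit :: "'s mdp \<Rightarrow> 's \<Rightarrow> bool" where
  "step_counter_implicit M s\<^sub>0 \<longleftrightarrow>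
     (\<forall>s\<in>states M. \<forall>h h'.
        partial_run M h \<and> hd h = s\<^sub>0 \<and> last h = s \<and>
        partial_run M h' \<and> hd h' = s\<^sub>0 \<and> last h' = s \<longrightarrow> length h = length h')"

definition runs :: "'s mdp \<Rightarrow> 's \<Rightarrow> (nat \<Rightarrow> 's) set" where
  "runs M s\<^sub>0 = {\<rho>. \<rho> 0 = s\<^sub>0 \<and> (\<forall>j. (\<rho> j, \<rho> (Suc j)) \<in> transitions M)}"

definition MP_liminf_nonneg :: "'s mdp \<Rightarrow> 's \<Rightarrow> (nat \<Rightarrow> 's) set" where
  "MP_liminf_nonneg M s\<^sub>0 =
     {\<rho> \<in> runs M s\<^sub>0. liminf (\<lambda>n. ereal (1 / real n * (\<Sum>j<n. reward M (\<rho> j, \<rho> (Suc j))))) \<ge> 0}"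


section \<open>Strategies and the induced measure on runs\<close>

text \<open>
  A strategy is a function on histories; its values matter only on partial runs ending in a
  controlled state.
\<close>

definition strategy :: "'s mdp \<Rightarrow> ('s list \<Rightarrow> 's pmf) \<Rightarrow> bool" where
  "strategy M \<sigma> \<longleftrightarrow>
     (\<forall>h. partial_run M h \<and> last h \<in> ctrl M \<longrightarrow> set_pmf (\<sigma> h) \<subseteq> succs M (last h))"

definition next_pmf :: "'s mdp \<Rightarrow> ('s list \<Rightarrow> 's pmf) \<Rightarrow> 's list \<Rightarrow> 's pmf" where
  "next_pmf M \<sigma> h = (if last h \<in> ctrl M then \<sigma> h else succ_pmf M (last h))"

definition run_kernel ::
  "'s mdp \<Rightarrow> 's \<Rightarrow> ('s list \<Rightarrow> 's pmf) \<Rightarrow> nat \<Rightarrow> (nat \<Rightarrow> 's) \<Rightarrow> 's pmf" where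
  "run_kernel M s\<^sub>0 \<sigma> n \<rho> = (if n = 0 then return_pmf s\<^sub>0 else next_pmf M \<sigma> (map \<rho> [0..<n]))"

text \<open>
  The measure \<open>\<P>\<^bsub>M,s\<^sub>0,\<sigma>\<^esub>\<close> on infinite state sequences, with the product sigma-algebra generated by
  the cylinder sets. It is the Ionescu-Tulcea extension of the one-step distributions;
  \<open>emeasure_run_measure_cylinder\<close> below gives its defining values on cylinders. The class
  \<open>countable\<close> on the state type makes every one-step kernel measurable.
\<close>

definition run_measure ::
  "'s::countable mdp \<Rightarrow> 's \<Rightarrow> ('s list \<Rightarrow> 's pmf) \<Rightarrow> (nat \<Rightarrow> 's) measure" where
  "run_measure M s\<^sub>0 \<sigma> =
     projective_family.lim UNIV
       (Ionescu_Tulcea.CI (\<lambda>n \<rho>. measure_pmf (run_kernel M s\<^sub>0 \<sigma> n \<rho>)) (\<lambda>_. count_space UNIV))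
       (\<lambda>_. count_space UNIV)"


section \<open>Memory\<close>

text \<open>
  An update function \<open>\<tau>\<close> chooses, from the current mode and state, jointly the next mode and the
  next state. At random states the next state has to follow the distribution fixed by the MDP, but
  the mode update may depend on it.
\<close>

definition memory_update :: "'s mdp \<Rightarrow> 'm set \<Rightarrow> ('m \<Rightarrow> 's \<Rightarrow> ('m \<times> 's) pmf) \<Rightarrow> bool" where
  "memory_update M Q \<tau> \<longleftrightarrow>
     (\<forall>m\<in>Q. \<forall>s\<in>ctrl M. set_pmf (\<tau> m s) \<subseteq> Q \<times> succs M s) \<and>
     (\<forall>m\<in>Q. \<forall>s\<in>rand M. fst ` set_pmf (\<tau> m s) \<subseteq> Q \<and> map_pmf snd (\<tau> m s) = succ_pmf M s)"

text \<open>
  Distribution of the first \<open>n\<close> steps of the Markov chain on modes and states which starts in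
  \<open>(m\<^sub>0, s\<^sub>0)\<close> and moves according to \<open>\<tau>\<close>.
\<close>

primrec memory_chain ::
  "('m \<Rightarrow> 's \<Rightarrow> ('m \<times> 's) pmf) \<Rightarrow> 'm \<Rightarrow> 's \<Rightarrow> nat \<Rightarrow> ('m \<times> 's) list pmf" where
  "memory_chain \<tau> m\<^sub>0 s\<^sub>0 0 = return_pmf [(m\<^sub>0, s\<^sub>0)]"
| "memory_chain \<tau> m\<^sub>0 s\<^sub>0 (Suc n) =
     bind_pmf (memory_chain \<tau> m\<^sub>0 s\<^sub>0 n)
       (\<lambda>w. map_pmf (\<lambda>p. w @ [p]) (\<tau> (fst (last w)) (snd (last w))))"

definition memory_lifts :: "'s list \<Rightarrow> ('m \<times> 's) list set" where
  "memory_lifts h = {w. map snd w = h}"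

definition consistent ::
  "('m \<Rightarrow> 's \<Rightarrow> ('m \<times> 's) pmf) \<Rightarrow> 'm \<Rightarrow> 's list \<Rightarrow> bool" where
  "consistent \<tau> m\<^sub>0 h \<longleftrightarrow>
     set_pmf (memory_chain \<tau> m\<^sub>0 (hd h) (length h - 1)) \<inter> memory_lifts h \<noteq> {}"

text \<open>
  Distribution of the current mode, conditioned on the observed partial run \<open>h\<close>. The conditioning
  is meaningful only if \<open>h\<close> is consistent, i.e. has positive probability.
\<close>

definition mode_pmf ::
  "('m \<Rightarrow> 's \<Rightarrow> ('m \<times> 's) pmf) \<Rightarrow> 'm \<Rightarrow> 's list \<Rightarrow> 'm pmf" where
  "mode_pmf \<tau> m\<^sub>0 h =
     map_pmf (\<lambda>w. fst (last w))
       (cond_pmf (memory_chain \<tau> m\<^sub>0 (hd h) (length h - 1)) (memory_lifts h))"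

definition induced_strategy ::
  "('m \<Rightarrow> 's \<Rightarrow> ('m \<times> 's) pmf) \<Rightarrow> 'm \<Rightarrow> 's list \<Rightarrow> 's pmf" where
  "induced_strategy \<tau> m\<^sub>0 h = bind_pmf (mode_pmf \<tau> m\<^sub>0 h) (\<lambda>m. map_pmf snd (\<tau> m (last h)))"

text \<open>
  On partial runs of probability zero the induced strategy is unspecified, so no agreement is
  demanded there.
\<close>

definition implements ::
  "'s mdp \<Rightarrow> ('m \<Rightarrow> 's \<Rightarrow> ('m \<times> 's) pmf) \<Rightarrow> 'm \<Rightarrow> ('s list \<Rightarrow> 's pmf) \<Rightarrow> bool" where
  "implements M \<tau> m\<^sub>0 \<sigma> \<longleftrightarrow>
     (\<forall>h. partial_run M h \<and> last h \<in> ctrl M \<and> consistent \<tau> m\<^sub>0 h \<longrightarrow>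
        \<sigma> h = induced_strategy \<tau> m\<^sub>0 h)"

text \<open>Natural numbers suffice as names for the finitely many modes.\<close>

definition FR_strategy :: "'s mdp \<Rightarrow> ('s list \<Rightarrow> 's pmf) \<Rightarrow> bool" where
  "FR_strategy M \<sigma> \<longleftrightarrow>
     strategy M \<sigma> \<and>
     (\<exists>(Q :: nat set) m\<^sub>0 \<tau>. finite Q \<and> m\<^sub>0 \<in> Q \<and> memory_update M Q \<tau> \<and> implements M \<tau> m\<^sub>0 \<sigma>)"

text \<open>
  The modes of a \<open>k\<close>-bit Markov strategy consist of a step counter, which every update increments
  by one, and \<open>k\<close> bits that are updated freely.
\<close>

definition kbit_modes :: "nat \<Rightarrow> (nat \<times> bool list) set" where
  "kbit_modes k = {(n, bs). length bs = k}"

definition kbit_Markov_strategy :: "nat \<Rightarrow> 's mdp \<Rightarrow> ('s list \<Rightarrow> 's pmf) \<Rightarrow> bool" where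
  "kbit_Markov_strategy k M \<sigma> \<longleftrightarrow>
     strategy M \<sigma> \<and>
     (\<exists>bs\<^sub>0 \<tau>. length bs\<^sub>0 = k \<and> memory_update M (kbit_modes k) \<tau> \<and>
        (\<forall>n bs. \<forall>s\<in>states M. length bs = k \<longrightarrow>
           (\<forall>((n', bs'), s')\<in>set_pmf (\<tau> (n, bs) s). n' = Suc n)) \<and>
        implements M \<tau> (0, bs\<^sub>0) \<sigma>)"


section \<open>Basic facts on the measure on runs\<close>

lemma measurable_map_upt:
  "(\<lambda>\<rho>. map \<rho> [0..<n]) \<in>
     measurable (PiM {0..<n} (\<lambda>_. count_space (UNIV :: 's::countable set))) (count_space UNIV)"
proof (subst measurable_count_space_eq2_countable, safe)
  fix h :: "'s list"
  let ?N = "PiM {0..<n} (\<lambda>_. count_space (UNIV :: 's set))"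
  have *: "(\<lambda>\<rho>. map \<rho> [0..<n]) -` {h} \<inter> space ?N =
      (if length h = n then PiE {0..<n} (\<lambda>i. {h ! i}) else {})"
    by (simp add: space_PiM set_eq_iff PiE_iff list_eq_iff_nth_eq) (metis atLeastLessThan_iff zero_le)
  show "(\<lambda>\<rho>. map \<rho> [0..<n]) -` {h} \<inter> space ?N \<in> sets ?N"
    unfolding * by (auto intro!: sets_PiM_I_finite)
qed auto

lemma Ionescu_Tulcea_run_kernel:
  "Ionescu_Tulcea (\<lambda>n \<rho>. measure_pmf (run_kernel M s\<^sub>0 \<sigma> n (\<rho> :: nat \<Rightarrow> 's::countable)))
     (\<lambda>_. count_space UNIV)"
proof
  fix n :: nat
  have "(\<lambda>h. measure_pmf (if n = 0 then return_pmf s\<^sub>0 else next_pmf M \<sigma> h)) \<in>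
      measurable (count_space UNIV) (subprob_algebra (count_space (UNIV :: 's set)))"
    by (simp add: space_subprob_algebra measure_pmf.subprob_space_axioms)
  from measurable_compose[OF measurable_map_upt this]
  show "(\<lambda>\<rho>. measure_pmf (run_kernel M s\<^sub>0 \<sigma> n \<rho>)) \<in>
      measurable (PiM {0..<n} (\<lambda>_. count_space UNIV)) (subprob_algebra (count_space UNIV))"
    by (simp add: run_kernel_def)
qed

lemma sets_run_measure [simp, measurable_cong]:
  "sets (run_measure M s\<^sub>0 \<sigma>) = sets (PiM UNIV (\<lambda>_. count_space UNIV))"
  unfolding run_measure_def
proof -
  interpret Ionescu_Tulcea "\<lambda>n \<rho>. measure_pmf (run_kernel M s\<^sub>0 \<sigma> n \<rho>)" "\<lambda>_. count_space UNIV"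
    by (rule Ionescu_Tulcea_run_kernel)
  show "sets PF.lim = sets (PiM UNIV (\<lambda>_. count_space UNIV))"
    by (rule PF.sets_lim)
qed

lemma space_run_measure [simp]: "space (run_measure M s\<^sub>0 \<sigma>) = UNIV"
  using sets_eq_imp_space_eq[OF sets_run_measure, of M s\<^sub>0 \<sigma>] by (simp add: space_PiM)

lemma emeasure_run_measure_cylinder:
  "emeasure (run_measure M s\<^sub>0 \<sigma>) {\<rho>. \<forall>i<n. \<rho> i = h i} =
     ennreal (\<Prod>i<n. pmf (run_kernel M s\<^sub>0 \<sigma> i h) (h i))"
proof -
  let ?S = "\<lambda>_::nat. count_space (UNIV :: 'a set)"
  let ?E = "\<lambda>n. PiE {0..<n} (\<lambda>i. {h i})"
  interpret Ionescu_Tulcea "\<lambda>n \<rho>. measure_pmf (run_kernel M s\<^sub>0 \<sigma> n \<rho>)" ?S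
    by (rule Ionescu_Tulcea_run_kernel)
  have E[measurable]: "?E n \<in> sets (PiM {0..<n} ?S)" for n
    by (intro sets_PiM_I_finite) auto
  have C: "emeasure (C 0 n (\<lambda>_. undefined)) (?E n) =
      ennreal (\<Prod>i<n. pmf (run_kernel M s\<^sub>0 \<sigma> i h) (h i))" for n
  proof (induction n)
    case 0
    have "emeasure (return (PiM {0..<0} ?S) (\<lambda>_. undefined)) (?E 0) = indicator (?E 0) (\<lambda>_. undefined)"
      by (rule emeasure_return) (rule E)
    then show ?case by simp
  next
    case (Suc n)
    let ?p = "pmf (run_kernel M s\<^sub>0 \<sigma> n h) (h n)"
    have ud: "(\<lambda>_. undefined) \<in> space (PiM {0..<0} ?S)"
      by (simp add: space_PiM)
    have eP: "emeasure (eP n \<rho>) (?E (Suc n)) = ennreal ?p * indicator (?E n) \<rho>"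
      if \<rho>: "\<rho> \<in> space (PiM {0..<n} ?S)" for \<rho>
    proof -
      have "(\<lambda>x. \<rho>(n := x)) -` ?E (Suc n) = (if \<rho> \<in> ?E n then {h n} else {})"
        using \<rho> by (auto simp: space_PiM PiE_iff extensional_def less_Suc_eq split: if_splits)
      moreover have "run_kernel M s\<^sub>0 \<sigma> n \<rho> = run_kernel M s\<^sub>0 \<sigma> n h" if "\<rho> \<in> ?E n"
      proof -
        have "map \<rho> [0..<n] = map h [0..<n]"
          using that by (auto simp: PiE_iff)
        then show ?thesis unfolding run_kernel_def by metis
      qed
      ultimately show ?thesis
        using \<rho> E[of "Suc n"] by (subst emeasure_eP) (auto simp: emeasure_pmf_single)
    qed
    have "emeasure (C 0 (Suc n) (\<lambda>_. undefined)) (?E (Suc n)) =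
        (\<integral>\<^sup>+\<rho>. emeasure (eP n \<rho>) (?E (Suc n)) \<partial>C 0 n (\<lambda>_. undefined))"
    proof -
      have "sets (C 0 n (\<lambda>_. undefined)) = sets (PiM {0..<n} ?S)"
        using sets_C[OF ud, of n] by (simp only: add_0)
      then have "eP n \<in> measurable (C 0 n (\<lambda>_. undefined)) (subprob_algebra (PiM {0..<Suc n} ?S))"
        using measurable_eP[of n] measurable_cong_sets by blast
      from emeasure_bind[OF prob_space.not_empty[OF prob_space_C[OF ud]] this E]
      show ?thesis by (simp only: C.simps add_0)
    qed
    also have "\<dots> = (\<integral>\<^sup>+\<rho>. ennreal ?p * indicator (?E n) \<rho> \<partial>C 0 n (\<lambda>_. undefined))"
      using space_C[OF ud, of n] by (intro nn_integral_cong eP) simp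
    also have "\<dots> = ennreal ?p * emeasure (C 0 n (\<lambda>_. undefined)) (?E n)"
      using sets_C[OF ud, of n] E[of n] by (subst nn_integral_cmult_indicator) auto
    also have "\<dots> = ennreal (\<Prod>i<Suc n. pmf (run_kernel M s\<^sub>0 \<sigma> i h) (h i))"
      unfolding Suc.IH by (simp add: ennreal_mult' mult.commute prod_nonneg)
    finally show ?case .
  qed
  have "{\<rho>. \<forall>i<n. \<rho> i = h i} = PF.emb UNIV {0..<n} (?E n)"
    by (auto simp: prod_emb_def space_PiM PiE_iff)
  then have "emeasure PF.lim {\<rho>. \<forall>i<n. \<rho> i = h i} = emeasure (CI {0..<n}) (?E n)"
    using lim[of "{0..<n}" "?E n"] E by simp
  also have "\<dots> = emeasure (C 0 n (\<lambda>_. undefined)) (?E n)"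
    using emeasure_CI[of "{0..<n}" n "?E n"] E[of n] sets.sets_into_space[OF E[of n]]
    by (simp add: prod_emb_id space_PiM)
  finally show ?thesis
    unfolding run_measure_def C .
qed

lemma prob_space_run_measure: "prob_space (run_measure M s\<^sub>0 \<sigma>)"
  using emeasure_run_measure_cylinder[of M s\<^sub>0 \<sigma> 0] by (intro prob_spaceI) simp

lemma MP_liminf_nonneg_in_sets:
  "MP_liminf_nonneg M s\<^sub>0 \<in> sets (run_measure (M :: 's::countable mdp) s\<^sub>0 \<sigma>)"
proof -
  let ?N = "PiM UNIV (\<lambda>_::nat. count_space (UNIV :: 's set))"
  have pair: "(\<lambda>\<rho>. (\<rho> j, \<rho> (Suc j))) \<in> measurable ?N (count_space UNIV)" for j
  proof (subst measurable_count_space_eq2_countable, safe)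
    fix a b
    have "(\<lambda>\<rho>. (\<rho> j, \<rho> (Suc j))) -` {(a, b)} \<inter> space ?N =
        {\<rho>\<in>space ?N. \<rho> j \<in> {a}} \<inter> {\<rho>\<in>space ?N. \<rho> (Suc j) \<in> {b}}"
      by auto
    also have "\<dots> \<in> sets ?N"
      by (intro sets.Int sets_Collect_single) auto
    finally show "(\<lambda>\<rho>. (\<rho> j, \<rho> (Suc j))) -` {(a, b)} \<inter> space ?N \<in> sets ?N" .
  qed auto
  note [measurable] = measurable_compose[OF pair measurable_count_space]
  have [measurable]: "(\<lambda>\<rho>. reward M (\<rho> j, \<rho> (Suc j))) \<in> borel_measurable ?N" for j
    by (rule measurable_compose[OF pair]) simp
  have [measurable]: "Measurable.pred ?N (\<lambda>\<rho>. (\<rho> j, \<rho> (Suc j)) \<in> transitions M)" for j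
    by (rule measurable_compose[OF pair]) simp
  have [measurable]: "Measurable.pred ?N (\<lambda>\<rho>. \<rho> 0 = s\<^sub>0)"
    using measurable_compose[OF measurable_component_singleton[of 0 UNIV "\<lambda>_. count_space (UNIV :: 's set)"],
        of "\<lambda>s. s = s\<^sub>0"] by simp
  have "{\<rho>\<in>space ?N. (\<rho> 0 = s\<^sub>0 \<and> (\<forall>j. (\<rho> j, \<rho> (Suc j)) \<in> transitions M)) \<and>
      liminf (\<lambda>n. ereal (1 / real n * (\<Sum>j<n. reward M (\<rho> j, \<rho> (Suc j))))) \<ge> 0} \<in> sets ?N"
    by measurable
  then show ?thesis
    by (simp add: MP_liminf_nonneg_def runs_def space_PiM)
qed

end

theory Submission
  imports Defs "HOL-Real_Asymp.Real_Asymp"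
begin

text \<open>
  The MDP is a chain of gadgets. In each one a random level is drawn and a reward proportional to it
  is credited. This credit is visible only in the total reward, since all levels lead to the same
  state, where the player must pay for some level. Paying more than the credit pushes the mean payoff
  below \<open>-1\<close>; paying for a low level increases the risk of an accident, which does the same
  until it is refunded. Paying for exactly the drawn level keeps the total at \<open>0\<close>, and accidents
  then have summable probabilities, so almost surely only finitely many occur. With \<open>q\<close> memory modes,
  two of more than \<open>q\<close> levels are confused with positive probability. The resulting failures have
  conditional probabilities with divergent sum, so almost surely infinitely many occur. Only the number of
  modes available at each step matters, so a step counter does not help.
\<close>

section \<open>Histories and memory\<close>

text \<open>Credit could be hoarded: underpaying leaves a surplus that might cover later failures.
  Hence the stakes grow so fast that one unit in gadget \<open>n\<close> outweighs all credit
  obtainable before it, and a single failure makes the mean at most \<open>-1\<close> at some time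
  of the gadget, whatever the past. A winning run therefore has only finitely many failures.
  Failures in different gadgets are dependent, because modes persist. Their probability is therefore
  bounded from below for every mode at the start of a gadget; the survival bounds then multiply as
  if gadgets were independent.\<close>

primrec hist_pmf :: "'s mdp \<Rightarrow> 's \<Rightarrow> ('s list \<Rightarrow> 's pmf) \<Rightarrow> nat \<Rightarrow> 's list pmf" where
  "hist_pmf M s\<^sub>0 \<sigma> 0 = return_pmf [s\<^sub>0]"
| "hist_pmf M s\<^sub>0 \<sigma> (Suc n) =
     bind_pmf (hist_pmf M s\<^sub>0 \<sigma> n) (\<lambda>h. map_pmf (\<lambda>s. h @ [s]) (next_pmf M \<sigma> h))"

lemma pmf_bind_snoc:
  "pmf (bind_pmf P (\<lambda>h. map_pmf (\<lambda>s. h @ [s]) (f h))) (h' @ [s]) = pmf P h' * pmf (f h') s"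
proof -
  have "ennreal (pmf (bind_pmf P (\<lambda>h. map_pmf (\<lambda>s. h @ [s]) (f h))) (h' @ [s])) =
      (\<integral>\<^sup>+h. ennreal (pmf (f h') s) * indicator {h'} h \<partial>measure_pmf P)"
    unfolding ennreal_pmf_bind
  proof (intro nn_integral_cong)
    fix h
    have "(\<lambda>s. h @ [s]) -` {h' @ [s]} = (if h = h' then {s} else {})"
      by auto
    then show "ennreal (pmf (map_pmf (\<lambda>s. h @ [s]) (f h)) (h' @ [s])) =
        ennreal (pmf (f h') s) * indicator {h'} h"
      by (simp add: ennreal_pmf_map emeasure_pmf_single)
  qed
  also have "\<dots> = ennreal (pmf P h' * pmf (f h') s)"
    by (simp add: nn_integral_cmult_indicator emeasure_pmf_single ennreal_mult' mult.commute)
  finally show ?thesis by simp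
qed

lemma hist_pmf_length: "h \<in> set_pmf (hist_pmf M s\<^sub>0 \<sigma> n) \<Longrightarrow> length h = Suc n"
  by (induction n arbitrary: h) auto

lemma run_kernel_nth:
  "run_kernel M s\<^sub>0 \<sigma> (Suc i) ((!) h) = next_pmf M \<sigma> (take (Suc i) h)" if "i < length h"
proof -
  have "map ((!) h) [0..<Suc i] = take (Suc i) h"
    using that by (intro nth_equalityI) (auto simp: less_Suc_eq nth_append)
  then show ?thesis by (simp only: run_kernel_def nat.simps if_False)
qed

text \<open>Both sides factor into one-step kernels. The right side is the value of a cylinder in
  \<open>emeasure_run_measure_cylinder\<close>, with \<open>(!) h\<close> as a run through
  \<open>h\<close> whose values past the end of \<open>h\<close> do not enter.\<close>

lemma pmf_hist_pmf:
  "length h = Suc n \<Longrightarrow>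
     pmf (hist_pmf M s\<^sub>0 \<sigma> n) h = (\<Prod>i<Suc n. pmf (run_kernel M s\<^sub>0 \<sigma> i ((!) h)) (h ! i))"
proof (induction n arbitrary: h)
  case 0
  then obtain s where "h = [s]" by (cases h) auto
  then show ?case by (simp add: run_kernel_def indicator_def)
next
  case (Suc n)
  then obtain h' s where h: "h = h' @ [s]" "length h' = Suc n"
    by (cases h rule: rev_cases) auto
  have eq: "pmf (run_kernel M s\<^sub>0 \<sigma> i ((!) h)) (h ! i) = pmf (run_kernel M s\<^sub>0 \<sigma> i ((!) h')) (h' ! i)"
    if "i < Suc n" for i
  proof (cases i)
    case 0
    with h show ?thesis by (simp add: run_kernel_def nth_append)
  next
    case (Suc j)
    with h that show ?thesis by (simp add: run_kernel_nth nth_append)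
  qed
  have "pmf (hist_pmf M s\<^sub>0 \<sigma> (Suc n)) h = pmf (hist_pmf M s\<^sub>0 \<sigma> n) h' * pmf (next_pmf M \<sigma> h') s"
    unfolding h hist_pmf.simps by (rule pmf_bind_snoc)
  also have "\<dots> = (\<Prod>i<Suc n. pmf (run_kernel M s\<^sub>0 \<sigma> i ((!) h)) (h ! i)) * pmf (next_pmf M \<sigma> h') s"
    using Suc.IH[OF h(2)] eq by simp
  also have "next_pmf M \<sigma> h' = run_kernel M s\<^sub>0 \<sigma> (Suc n) ((!) h)"
    using h by (subst run_kernel_nth) auto
  finally have "pmf (hist_pmf M s\<^sub>0 \<sigma> (Suc n)) h =
      (\<Prod>i<Suc n. pmf (run_kernel M s\<^sub>0 \<sigma> i ((!) h)) (h ! i)) *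
      pmf (run_kernel M s\<^sub>0 \<sigma> (Suc n) ((!) h)) s" .
  moreover have "h ! Suc n = s" using h by (simp add: nth_append)
  ultimately show ?case by (simp only: prod.lessThan_Suc[of _ "Suc n"])
qed

section \<open>Law of finite prefixes under the run measure\<close>

lemma measurable_prefix:
  "(\<lambda>\<rho>. map \<rho> [0..<n]) \<in>
     measurable (PiM UNIV (\<lambda>_. count_space (UNIV :: 's::countable set))) (count_space UNIV)"
proof (subst measurable_count_space_eq2_countable, safe)
  fix h :: "'s list"
  let ?N = "PiM UNIV (\<lambda>_::nat. count_space (UNIV :: 's set))"
  have "(\<lambda>\<rho>. map \<rho> [0..<n]) -` {h} \<inter> space ?N =
      (if length h = n then {\<rho>\<in>space ?N. \<forall>i\<in>{..<n}. \<rho> i \<in> {h ! i}} else {})"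
    by (simp add: space_PiM set_eq_iff list_eq_iff_nth_eq) blast
  also have "\<dots> \<in> sets ?N"
    by (auto intro!: sets.sets_Collect_finite_All' sets_Collect_single)
  finally show "(\<lambda>\<rho>. map \<rho> [0..<n]) -` {h} \<inter> space ?N \<in> sets ?N" .
qed auto

lemma measurable_prefix_run_measure:
  "(\<lambda>\<rho>. map \<rho> [0..<n]) \<in> measurable (run_measure M s\<^sub>0 \<sigma>) (count_space UNIV)"
  by (subst measurable_cong_sets[OF sets_run_measure refl]) (rule measurable_prefix)

text \<open>There are countably many lists, so agreement on singletons suffices; a singleton pulls
  back to a cylinder or, at a wrong length, to the empty set.\<close>

lemma distr_run_measure_prefix:
  "distr (run_measure M s\<^sub>0 \<sigma>) (count_space UNIV) (\<lambda>\<rho>. map \<rho> [0..<Suc n]) =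
     measure_pmf (hist_pmf M s\<^sub>0 \<sigma> n)" for M :: "'s::countable mdp"
proof (rule measure_eqI_countable[where A = UNIV])
  note m = measurable_prefix_run_measure[of "Suc n" M s\<^sub>0 \<sigma>]
  fix h :: "'s list"
  have *: "(\<lambda>\<rho>. map \<rho> [0..<Suc n]) -` {h} =
      (if length h = Suc n then {\<rho>. \<forall>i<Suc n. \<rho> i = h ! i} else {})"
    by (auto simp: list_eq_iff_nth_eq less_Suc_eq nth_append)
  have "emeasure (distr (run_measure M s\<^sub>0 \<sigma>) (count_space UNIV) (\<lambda>\<rho>. map \<rho> [0..<Suc n])) {h} =
      emeasure (run_measure M s\<^sub>0 \<sigma>) ((\<lambda>\<rho>. map \<rho> [0..<Suc n]) -` {h})"
    using m by (subst emeasure_distr) auto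
  also have "\<dots> = ennreal (pmf (hist_pmf M s\<^sub>0 \<sigma> n) h)"
  proof (cases "length h = Suc n")
    case True
    show ?thesis
      unfolding * if_P[OF True] pmf_hist_pmf[OF True] by (rule emeasure_run_measure_cylinder)
  next
    case False
    then have "h \<notin> set_pmf (hist_pmf M s\<^sub>0 \<sigma> n)" by (auto dest: hist_pmf_length)
    with False show ?thesis unfolding * by (simp add: set_pmf_iff)
  qed
  finally show "emeasure (distr (run_measure M s\<^sub>0 \<sigma>) (count_space UNIV) (\<lambda>\<rho>. map \<rho> [0..<Suc n])) {h} =
      emeasure (measure_pmf (hist_pmf M s\<^sub>0 \<sigma> n)) {h}"
    by (simp add: emeasure_pmf_single)
qed auto

lemma prefix_event_in_sets:
  "{\<rho>. map \<rho> [0..<n] \<in> B} \<in> sets (run_measure M s\<^sub>0 \<sigma>)" for M :: "'s::countable mdp"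
  using measurable_sets[OF measurable_prefix_run_measure, of B n M s\<^sub>0 \<sigma>] by (simp add: vimage_def)

lemma emeasure_run_measure_prefix:
  "emeasure (run_measure M s\<^sub>0 \<sigma>) {\<rho>. map \<rho> [0..<Suc n] \<in> B} =
     emeasure (measure_pmf (hist_pmf M s\<^sub>0 \<sigma> n)) B" for M :: "'s::countable mdp"
proof -
  note m = measurable_prefix_run_measure[of "Suc n" M s\<^sub>0 \<sigma>]
  show ?thesis
    unfolding distr_run_measure_prefix[symmetric] using m
    by (subst emeasure_distr) (auto simp: vimage_def)
qed

lemma AE_prefix_in_hist_pmf:
  "AE \<rho> in run_measure M s\<^sub>0 \<sigma>. \<forall>n. map \<rho> [0..<Suc n] \<in> set_pmf (hist_pmf M s\<^sub>0 \<sigma> n)"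
  for M :: "'s::countable mdp"
proof -
  interpret prob_space "run_measure M s\<^sub>0 \<sigma>" by (rule prob_space_run_measure)
  have "AE \<rho> in run_measure M s\<^sub>0 \<sigma>. map \<rho> [0..<Suc n] \<in> set_pmf (hist_pmf M s\<^sub>0 \<sigma> n)" for n
  proof -
    have "emeasure (run_measure M s\<^sub>0 \<sigma>) {\<rho>. map \<rho> [0..<Suc n] \<in> set_pmf (hist_pmf M s\<^sub>0 \<sigma> n)} = 1"
      unfolding emeasure_run_measure_prefix
      by (simp add: measure_pmf.emeasure_eq_measure measure_pmf.prob_eq_1 AE_measure_pmf_iff)
    then have "prob {\<rho>. map \<rho> [0..<Suc n] \<in> set_pmf (hist_pmf M s\<^sub>0 \<sigma> n)} = 1"
      by (simp only: emeasure_eq_measure ennreal_eq_1)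
    then show ?thesis
      by (simp only: prob_eq_1[OF prefix_event_in_sets] mem_Collect_eq)
  qed
  then show ?thesis unfolding AE_all_countable by blast
qed

section \<open>From conditioned modes to the chain of modes and states\<close>

text \<open>Law of total probability: drawing the value of \<open>f\<close> first and then a point
  of its fibre reproduces \<open>p\<close>.\<close>

lemma cond_pmf_fibres:
  "bind_pmf (map_pmf f p) (\<lambda>y. cond_pmf p (f -` {y})) = p"
proof -
  have "f -` {y} = {x. y = f x}" for y by auto
  then have "bind_pmf (map_pmf f p) (\<lambda>y. cond_pmf p (f -` {y})) =
      bind_pmf (map_pmf f p) (\<lambda>y. cond_pmf p {x. y = f x})" by simp
  also have "\<dots> = p"
  proof (rule bind_cond_pmf_cancel)
    fix x y assume "x \<in> set_pmf (map_pmf f p)" "y \<in> set_pmf p" "x = f y"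
    have "measure (map_pmf f p) {x. x = f y} = measure p (f -` {x. x = f y})"
      by (simp add: measure_map_pmf)
    moreover have "f -` {x. x = f y} = {y. x = f y}" using \<open>x = f y\<close> by auto
    ultimately show "measure p {y. x = f y} = measure (map_pmf f p) {x. x = f y}" by simp
  qed auto
  finally show ?thesis .
qed

text \<open>
  Two instances are needed: constant mode sets for FR strategies, and mode sets
  that follow the step counter for Markov strategies.
\<close>

definition timed_update ::
  "'s mdp \<Rightarrow> (nat \<Rightarrow> 'm set) \<Rightarrow> ('m \<Rightarrow> 's \<Rightarrow> ('m \<times> 's) pmf) \<Rightarrow> bool" where
  "timed_update M Q \<tau> \<longleftrightarrow>
     (\<forall>n. \<forall>m\<in>Q n. \<forall>s\<in>ctrl M. set_pmf (\<tau> m s) \<subseteq> Q (Suc n) \<times> succs M s) \<and>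
     (\<forall>n. \<forall>m\<in>Q n. \<forall>s\<in>rand M.
        fst ` set_pmf (\<tau> m s) \<subseteq> Q (Suc n) \<and> map_pmf snd (\<tau> m s) = succ_pmf M s)"

lemma timed_update_step:
  assumes wf: "wf_mdp M" and \<tau>: "timed_update M Q \<tau>" and m: "m \<in> Q n" and s: "s \<in> states M"
    and p: "(m', s') \<in> set_pmf (\<tau> m s)"
  shows "m' \<in> Q (Suc n)" "(s, s') \<in> transitions M" "s' \<in> states M"
proof -
  have "m' \<in> Q (Suc n) \<and> (s, s') \<in> transitions M"
  proof (cases "s \<in> ctrl M")
    case True
    with \<tau> m p show ?thesis by (auto simp: timed_update_def succs_def)
  next
    case False
    with s have r: "s \<in> rand M" by (simp add: states_def)
    have "s' \<in> set_pmf (map_pmf snd (\<tau> m s))" using p by force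
    also have "map_pmf snd (\<tau> m s) = succ_pmf M s" using \<tau> m r by (simp add: timed_update_def)
    finally have "(s, s') \<in> transitions M" using wf r by (auto simp: wf_mdp_def succs_def)
    moreover have "m' \<in> Q (Suc n)" using \<tau> m r p by (force simp: timed_update_def)
    ultimately show ?thesis by simp
  qed
  then show "m' \<in> Q (Suc n)" "(s, s') \<in> transitions M" "s' \<in> states M"
    using wf by (auto simp: wf_mdp_def)
qed

lemma partial_run_snoc:
  "partial_run M (h @ [s])"
  if "partial_run M h" "(last h, s) \<in> transitions M" "s \<in> states M"
  using that unfolding partial_run_def
  by (auto simp: nth_append less_Suc_eq last_conv_nth)
    (metis One_nat_def Suc_lessI diff_Suc_1)

text \<open>The part \<open>fst (last w) \<in> Q n\<close> ties the mode to the step number; it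
  later bounds the number of modes available at a payment.\<close>

lemma memory_chain_support:
  assumes wf: "wf_mdp M" and \<tau>: "timed_update M Q \<tau>" and m: "m\<^sub>0 \<in> Q 0" and s: "s\<^sub>0 \<in> states M"
  shows "w \<in> set_pmf (memory_chain \<tau> m\<^sub>0 s\<^sub>0 n) \<Longrightarrow>
    length w = Suc n \<and> hd w = (m\<^sub>0, s\<^sub>0) \<and> fst (last w) \<in> Q n \<and> partial_run M (map snd w)"
proof (induction n arbitrary: w)
  case 0
  with m s show ?case by (auto simp: partial_run_def)
next
  case (Suc n)
  then obtain v m' s' where v: "v \<in> set_pmf (memory_chain \<tau> m\<^sub>0 s\<^sub>0 n)"
    and p: "(m', s') \<in> set_pmf (\<tau> (fst (last v)) (snd (last v)))" and w: "w = v @ [(m', s')]"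
    by auto
  note IH = Suc.IH[OF v]
  then have [simp]: "v \<noteq> []" and pr: "partial_run M (map snd v)" by auto
  then have "snd (last v) \<in> states M"
    by (auto simp: partial_run_def)
  note st = timed_update_step[OF wf \<tau> _ this p, of n]
  with IH w pr show ?case
    by (auto intro!: partial_run_snoc simp: last_map)
qed

text \<open>The strategy draws from the conditional law of the mode given the history. Averaging
  over histories undoes this conditioning, so the observed states follow the projected chain, where
  the mode is explicit.\<close>

lemma hist_pmf_eq_memory_chain:
  assumes wf: "wf_mdp M" and \<tau>: "timed_update M Q \<tau>" and m: "m\<^sub>0 \<in> Q 0" and s: "s\<^sub>0 \<in> states M"
    and \<sigma>: "implements M \<tau> m\<^sub>0 \<sigma>"
  shows "hist_pmf M s\<^sub>0 \<sigma> n = map_pmf (map snd) (memory_chain \<tau> m\<^sub>0 s\<^sub>0 n)"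
proof (induction n)
  case 0
  show ?case by simp
next
  case (Suc n)
  let ?MC = "memory_chain \<tau> m\<^sub>0 s\<^sub>0 n"
  let ?H = "map_pmf (map snd) ?MC"
  let ?\<kappa> = "\<lambda>w. map_pmf snd (\<tau> (fst (last w)) (snd (last w)))"
  note supp = memory_chain_support[OF wf \<tau> m s]
  have step: "next_pmf M \<sigma> h = bind_pmf (cond_pmf ?MC (map snd -` {h})) ?\<kappa>"
    if "h \<in> set_pmf ?H" for h
  proof -
    from that obtain w where w: "w \<in> set_pmf ?MC" "h = map snd w" by auto
    have ne: "set_pmf ?MC \<inter> map snd -` {h} \<noteq> {}" using w by auto
    have inC: "v \<in> set_pmf (cond_pmf ?MC (map snd -` {h})) \<Longrightarrow> v \<in> set_pmf ?MC \<and> map snd v = h" for v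
      using set_cond_pmf[OF ne] by auto
    have h: "partial_run M h" "hd h = s\<^sub>0" "length h = Suc n"
      using supp[OF w(1)] w(2) by (auto simp: hd_map) (metis length_0_conv hd_map list.size(3) nat.distinct(1) snd_conv)
    have lastv: "snd (last v) = last h" if "map snd v = h" for v
      using that h by (metis last_map length_0_conv nat.distinct(1) list.map_disc_iff)
    show ?thesis
    proof (cases "last h \<in> ctrl M")
      case True
      \<comment> \<open>Agreement with the induced strategy is demanded only at positive
        probability, which membership of \<open>h\<close> in the support provides.\<close>
      have "consistent \<tau> m\<^sub>0 h"
        using ne h by (simp add: consistent_def memory_lifts_def vimage_def)
      then have "\<sigma> h = induced_strategy \<tau> m\<^sub>0 h"
        using \<sigma> h True by (simp add: implements_def)
      also have "\<dots> = bind_pmf (cond_pmf ?MC (map snd -` {h}))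
          (\<lambda>w. map_pmf snd (\<tau> (fst (last w)) (last h)))"
        using h by (simp add: induced_strategy_def mode_pmf_def bind_map_pmf memory_lifts_def vimage_def)
      also have "\<dots> = bind_pmf (cond_pmf ?MC (map snd -` {h})) ?\<kappa>"
      proof (intro bind_pmf_cong refl)
        fix v assume "v \<in> set_pmf (cond_pmf ?MC (map snd -` {h}))"
        then have "snd (last v) = last h" using inC lastv by blast
        then show "map_pmf snd (\<tau> (fst (last v)) (last h)) = ?\<kappa> v" by simp
      qed
      finally show ?thesis using True by (simp add: next_pmf_def)
    next
      case False
      have "last h \<in> states M" using h by (auto simp: partial_run_def)
      with False have r: "last h \<in> rand M" by (simp add: states_def)
      have "bind_pmf (cond_pmf ?MC (map snd -` {h})) ?\<kappa> =
          bind_pmf (cond_pmf ?MC (map snd -` {h})) (\<lambda>_. succ_pmf M (last h))"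
      proof (intro bind_pmf_cong refl)
        fix v assume "v \<in> set_pmf (cond_pmf ?MC (map snd -` {h}))"
        with inC have v: "v \<in> set_pmf ?MC" "map snd v = h" by auto
        from supp[OF v(1)] have "fst (last v) \<in> Q n" by simp
        with r \<tau> lastv[OF v(2)] show "?\<kappa> v = succ_pmf M (last h)"
          by (auto simp: timed_update_def)
      qed
      with False show ?thesis by (simp add: next_pmf_def)
    qed
  qed
  have "map_pmf (map snd) (memory_chain \<tau> m\<^sub>0 s\<^sub>0 (Suc n)) =
      bind_pmf ?MC (\<lambda>w. map_pmf (\<lambda>s. map snd w @ [s]) (?\<kappa> w))"
    by (simp add: map_bind_pmf map_pmf_comp)
  \<comment> \<open>Splits the draw of \<open>w\<close> into its state history and \<open>w\<close>
    given that history, so that \<open>step\<close> applies to each fibre.\<close>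
  also have "\<dots> = bind_pmf (bind_pmf ?H (\<lambda>h. cond_pmf ?MC (map snd -` {h})))
      (\<lambda>w. map_pmf (\<lambda>s. map snd w @ [s]) (?\<kappa> w))"
    by (simp only: cond_pmf_fibres)
  also have "\<dots> = bind_pmf ?H (\<lambda>h. bind_pmf (cond_pmf ?MC (map snd -` {h}))
      (\<lambda>w. map_pmf (\<lambda>s. map snd w @ [s]) (?\<kappa> w)))"
    by (simp only: bind_assoc_pmf)
  also have "\<dots> = bind_pmf ?H (\<lambda>h. map_pmf (\<lambda>s. h @ [s]) (next_pmf M \<sigma> h))"
  proof (intro bind_pmf_cong refl)
    fix h assume h: "h \<in> set_pmf ?H"
    then have ne: "set_pmf ?MC \<inter> map snd -` {h} \<noteq> {}" by auto
    have "bind_pmf (cond_pmf ?MC (map snd -` {h})) (\<lambda>w. map_pmf (\<lambda>s. map snd w @ [s]) (?\<kappa> w)) =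
      bind_pmf (cond_pmf ?MC (map snd -` {h})) (\<lambda>w. map_pmf (\<lambda>s. h @ [s]) (?\<kappa> w))"
      using set_cond_pmf[OF ne] by (intro bind_pmf_cong refl) auto
    then show "bind_pmf (cond_pmf ?MC (map snd -` {h})) (\<lambda>w. map_pmf (\<lambda>s. map snd w @ [s]) (?\<kappa> w)) =
      map_pmf (\<lambda>s. h @ [s]) (next_pmf M \<sigma> h)"
      unfolding step[OF h] by (simp add: map_bind_pmf)
  qed
  finally show ?case using Suc.IH by simp
qed

section \<open>The MDP\<close>

text \<open>
  With \<open>B = base k\<close> and \<open>Z = block_length k\<close>, level \<open>i \<le> k\<close> has probability \<open>B^i / Z\<close> and paying for
  it has risk \<open>1 / B^(i + 1)\<close>. Paying for the right level then fails with probability \<open>(k + 1) / (B Z)\<close>,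
  whereas confusing two levels costs at least \<open>1 / Z\<close>. The levels up to \<open>k\<close> are used in \<open>Z\<close> consecutive
  gadgets, so that the first kind of failure is summable over all gadgets and the second is not.
\<close>

definition base :: "nat \<Rightarrow> nat" where
  "base k = (k + 1) * 2 ^ k"

definition block_length :: "nat \<Rightarrow> nat" where
  "block_length k = (\<Sum>i\<le>k. base k ^ i)"

definition block_start :: "nat \<Rightarrow> nat" where
  "block_start k = (\<Sum>l<k. block_length l)"

definition level :: "nat \<Rightarrow> nat" where
  "level n = (LEAST k. n < block_start (Suc k))"

section \<open>Blocks, level probabilities and the risk of matching\<close>

lemma base_pos [simp]: "0 < base k"
  by (simp add: base_def)

lemma block_length_pos [simp]: "0 < block_length k"
  unfolding block_length_def by (rule sum_pos) auto

lemma block_start_mono: "k \<le> l \<Longrightarrow> block_start k \<le> block_start l"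
  unfolding block_start_def by (rule sum_mono2) auto

lemma block_start_ge: "k \<le> block_start k"
proof (induction k)
  case (Suc k)
  have "block_start (Suc k) = block_start k + block_length k" by (simp add: block_start_def)
  with Suc block_length_pos[of k] show ?case by linarith
qed simp

lemma level_eq: "level n = k" if "block_start k \<le> n" "n < block_start (Suc k)"
  unfolding level_def
proof (rule Least_equality)
  fix l assume "n < block_start (Suc l)"
  show "k \<le> l"
  proof (rule ccontr)
    assume "\<not> k \<le> l"
    then have "block_start (Suc l) \<le> block_start k" by (intro block_start_mono) simp
    with that \<open>n < block_start (Suc l)\<close> show False by simp
  qed
qed (fact that)

lemma level_ge: "k \<le> level n" if "block_start k \<le> n"
proof -
  have "n < block_start (Suc (level n))"
    unfolding level_def by (rule LeastI[of _ n]) (use block_start_ge[of "Suc n"] in simp)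
  then show ?thesis
    using that block_start_mono[of "Suc (level n)" k] by (meson leD le_less_trans not_less_eq_eq)
qed

text \<open>\<open>level\<close> is constant on each block. Both the convergence of the matching
  risks and the divergence of the failure bounds are computed blockwise.\<close>

lemma sum_level:
  fixes f :: "nat \<Rightarrow> real"
  shows "k \<le> l \<Longrightarrow> (\<Sum>n\<in>{block_start k..<block_start l}. f (level n)) = (\<Sum>j\<in>{k..<l}. block_length j * f j)"
proof (induction rule: dec_induct)
  case (step l)
  have split: "{block_start k..<block_start (Suc l)} =
      {block_start k..<block_start l} \<union> {block_start l..<block_start (Suc l)}"
    using block_start_mono[of k l] block_start_mono[of l "Suc l"] step.hyps by auto
  have "(\<Sum>n\<in>{block_start l..<block_start (Suc l)}. f (level n)) =
      (\<Sum>n\<in>{block_start l..<block_start (Suc l)}. f l)"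
    by (intro sum.cong refl) (auto simp: level_eq)
  also have "\<dots> = block_length l * f l"
    by (simp add: block_start_def)
  finally show ?case
    unfolding split using step by (subst sum.union_disjoint) auto
qed simp

definition risk :: "nat \<Rightarrow> nat \<Rightarrow> real" where
  "risk k j = 1 / real (base k) ^ (j + 1)"

lemma risk_nonneg: "0 \<le> risk k j" and risk_le_1: "risk k j \<le> 1"
proof -
  have "1 \<le> real (base k) ^ (j + 1)"
    by (rule one_le_power) (simp add: Suc_leI)
  then show "0 \<le> risk k j" "risk k j \<le> 1"
    by (simp_all add: risk_def divide_le_eq del: power_Suc)
qed

lemma risk_antimono: "i \<le> j \<Longrightarrow> risk k j \<le> risk k i"
  unfolding risk_def by (intro divide_left_mono power_increasing) (auto simp: Suc_leI)

definition level_pmf :: "nat \<Rightarrow> nat pmf" where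
  "level_pmf k = embed_pmf (\<lambda>i. if i \<le> k then real (base k) ^ i / block_length k else 0)"

lemma pmf_level_pmf:
  "pmf (level_pmf k) i = (if i \<le> k then real (base k) ^ i / block_length k else 0)"
  unfolding level_pmf_def
proof (rule pmf_embed_pmf)
  let ?f = "\<lambda>i. if i \<le> k then real (base k) ^ i / block_length k else 0"
  have "(\<integral>\<^sup>+i. ennreal (?f i) \<partial>count_space UNIV) = (\<Sum>i\<le>k. ennreal (?f i))"
    by (subst nn_integral_count_space'[of "{..k}"]) auto
  also have "\<dots> = ennreal (\<Sum>i\<le>k. ?f i)" by (intro sum_ennreal) simp
  also have "(\<Sum>i\<le>k. ?f i) = (\<Sum>i\<le>k. real (base k) ^ i) / block_length k"
    by (simp add: sum_divide_distrib)
  also have "(\<Sum>i\<le>k. real (base k) ^ i) = real (block_length k)"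
    by (simp add: block_length_def)
  also have "\<dots> / block_length k = 1"
    by simp
  finally show "(\<integral>\<^sup>+i. ennreal (?f i) \<partial>count_space UNIV) = 1" by simp
qed simp

lemma set_level_pmf: "set_pmf (level_pmf k) = {..k}"
  by (auto simp: set_pmf_iff pmf_level_pmf split: if_splits)

definition match_risk :: "nat \<Rightarrow> real" where
  "match_risk n = (level n + 1) / (base (level n) * block_length (level n))"

text \<open>The powers of \<open>base\<close> in probability and risk cancel, so each of the
  \<open>level n + 1\<close> levels contributes the same amount.\<close>

lemma expected_match_risk:
  "(\<Sum>i\<le>level n. pmf (level_pmf (level n)) i * risk (level n) i) = match_risk n"
proof -
  have "(\<Sum>i\<le>level n. pmf (level_pmf (level n)) i * risk (level n) i) =
      (\<Sum>i\<le>level n. 1 / (base (level n) * block_length (level n)))"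
    by (intro sum.cong) (auto simp: pmf_level_pmf risk_def field_simps)
  then show ?thesis by (simp add: match_risk_def)
qed

text \<open>Summed over block \<open>k\<close>, the risks give
  \<open>(k + 1) / base k = 1 / 2 ^ k\<close>; the two factors of \<open>base k\<close> are chosen
  for this.\<close>

lemma summable_match_risk: "summable match_risk"
proof (rule summableI_nonneg_bounded)
  fix n
  show "0 \<le> match_risk n" by (simp add: match_risk_def)
  \<comment> \<open>By \<open>block_start_ge\<close> the first \<open>n\<close> gadgets lie in the
    first \<open>n\<close> blocks, so whole blocks can be summed.\<close>
  have "(\<Sum>i<n. match_risk i) \<le> (\<Sum>i\<in>{block_start 0..<block_start n}. match_risk i)"
    using block_start_ge[of n] by (intro sum_mono2) (auto simp: block_start_def match_risk_def)
  also have "\<dots> = (\<Sum>k\<in>{0..<n}. block_length k * (real (k + 1) / real (base k * block_length k)))"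
    unfolding match_risk_def by (subst sum_level) auto
  also have "\<dots> = (\<Sum>k\<in>{0..<n}. (1 / 2) ^ k)"
  proof (intro sum.cong refl)
    fix k
    have "block_length k * (real (k + 1) / real (base k * block_length k)) = real (k + 1) / real (base k)"
      by (simp add: field_simps)
    also have "\<dots> = (real k + 1) / ((real k + 1) * 2 ^ k)"
      by (simp only: base_def of_nat_mult of_nat_add of_nat_power of_nat_1 of_nat_numeral)
    also have "\<dots> = 1 / 2 ^ k"
      by (rule nonzero_divide_mult_cancel_left) linarith
    also have "\<dots> = (1 / 2) ^ k"
      by (simp add: power_one_over)
    finally show "block_length k * (real (k + 1) / real (base k * block_length k)) = (1 / 2) ^ k" .
  qed
  also have "\<dots> \<le> 2"
    using geometric_sum[of "1 / 2 :: real" n] by (simp add: atLeast0LessThan)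
  finally show "(\<Sum>i<n. match_risk i) \<le> 2" .
qed

text \<open>One unit \<open>scale n\<close> exceeds the sum of the maximal credits
  \<open>level g * scale g\<close> of all gadgets \<open>g < n\<close> by \<open>4 * n + 4\<close>,
  the time at the end of gadget \<open>n\<close>.\<close>

primrec scale :: "nat \<Rightarrow> nat" where
  "scale 0 = 4"
| "scale (Suc n) = scale n + level n * scale n + 4"

lemma scale_eq: "scale n = 4 * n + 4 + (\<Sum>g<n. level g * scale g)"
  by (induction n) auto

text \<open>
  A state is a pair of a time and a value. The \<open>n\<close>-th gadget occupies the times \<open>4n, \<dots>, 4n + 3\<close>:
  a random level \<open>i\<close> is drawn and credited, all levels merge into one controlled state, the player
  pays for a level \<open>j\<close>, and then an accident happens with probability \<open>risk k j\<close>. The loss caused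
  by an accident is refunded in the next transition.
\<close>

abbreviation state :: "nat \<Rightarrow> nat \<Rightarrow> nat" where
  "state t x \<equiv> prod_encode (t, x)"

definition time :: "nat \<Rightarrow> nat" where
  "time s = fst (prod_decode s)"

definition val :: "nat \<Rightarrow> nat" where
  "val s = snd (prod_decode s)"

lemma time_state [simp]: "time (state t x) = t" and val_state [simp]: "val (state t x) = x"
  by (simp_all add: time_def val_def)

lemma state_time_val [simp]: "state (time s) (val s) = s"
  by (simp add: time_def val_def)

text \<open>The time modulo 4 decides what a value encodes: accident flag, drawn level, nothing,
  level paid for. Width \<open>0\<close> at residue 2 merges the levels.\<close>

definition width :: "nat \<Rightarrow> nat" where
  "width t = (if t mod 4 = 0 then 1 else if t mod 4 = 2 then 0 else level (t div 4))"

definition val_pmf :: "nat \<Rightarrow> nat \<Rightarrow> nat pmf" where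
  "val_pmf t x =
     (if t mod 4 = 0 then level_pmf (level (t div 4))
      else if t mod 4 = 3 then map_pmf of_bool (bernoulli_pmf (risk (level (t div 4)) x))
      else return_pmf 0)"

text \<open>An accident in gadget \<open>n\<close> is charged \<open>scale (Suc n)\<close>, which
  also outweighs the credit of gadget \<open>n\<close> itself. Its refund falls into the next
  gadget, where \<open>time s div 4\<close> is already \<open>Suc n\<close>, so the amounts
  agree.\<close>

definition credit_reward :: "nat \<times> nat \<Rightarrow> int" where
  "credit_reward = (\<lambda>(s, s'). let n = time s div 4 in
     if time s mod 4 = 0 then val s' * scale n + (if val s = 0 then 0 else scale n)
     else if time s mod 4 = 2 then - (val s' * scale n)
     else if time s mod 4 = 3 \<and> val s' \<noteq> 0 then - scale (Suc n)
     else 0)"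

text \<open>Every natural number is a state; values above \<open>width\<close> can occur only at the
  start of a run, since no transition leads to them.\<close>

definition credit_mdp :: "nat mdp" where
  "credit_mdp =
     \<lparr>ctrl = {s. time s mod 4 = 2}, rand = {s. time s mod 4 \<noteq> 2},
      transitions = {(s, s'). time s' = Suc (time s) \<and> val s' \<le> width (Suc (time s))},
      succ_pmf = (\<lambda>s. map_pmf (state (Suc (time s))) (val_pmf (time s) (val s))),
      reward = (\<lambda>e. real_of_int (credit_reward e))\<rparr>"

section \<open>Structure of the MDP\<close>

lemma credit_mdp_simps [simp]:
  "s \<in> ctrl credit_mdp \<longleftrightarrow> time s mod 4 = 2"
  "s \<in> rand credit_mdp \<longleftrightarrow> time s mod 4 \<noteq> 2"
  "s \<in> states credit_mdp"
  "(s, s') \<in> transitions credit_mdp \<longleftrightarrow> time s' = Suc (time s) \<and> val s' \<le> width (Suc (time s))"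
  "succ_pmf credit_mdp s = map_pmf (state (Suc (time s))) (val_pmf (time s) (val s))"
  "reward credit_mdp e = real_of_int (credit_reward e)"
  by (auto simp: credit_mdp_def states_def)

lemma succs_credit_mdp:
  "succs credit_mdp s = state (Suc (time s)) ` {..width (Suc (time s))}"
proof (intro equalityI subsetI)
  fix s' assume "s' \<in> succs credit_mdp s"
  then have "time s' = Suc (time s)" "val s' \<le> width (Suc (time s))"
    by (auto simp: succs_def)
  then show "s' \<in> state (Suc (time s)) ` {..width (Suc (time s))}"
    by (metis atMost_iff image_eqI state_time_val)
next
  fix s' assume "s' \<in> state (Suc (time s)) ` {..width (Suc (time s))}"
  then show "s' \<in> succs credit_mdp s"
    by (auto simp: succs_def)
qed

lemma set_val_pmf: "set_pmf (val_pmf t x) \<subseteq> {..width (Suc t)}"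
proof -
  consider "t mod 4 = 0" | "t mod 4 = 3" | "t mod 4 \<noteq> 0" "t mod 4 \<noteq> 3" by blast
  then show ?thesis
  proof cases
    case 1
    then have "Suc t mod 4 = 1" "Suc t div 4 = t div 4" by presburger+
    then have "width (Suc t) = level (t div 4)" by (simp only: width_def) simp
    with 1 show ?thesis by (simp add: val_pmf_def set_level_pmf)
  next
    case 2
    then have "Suc t mod 4 = 0" by presburger
    then have "width (Suc t) = 1" by (simp only: width_def) simp
    with 2 show ?thesis by (auto simp: val_pmf_def)
  next
    case 3
    then show ?thesis by (simp add: val_pmf_def)
  qed
qed

lemma wf_credit_mdp: "wf_mdp credit_mdp"
  unfolding wf_mdp_def succs_credit_mdp
proof (intro conjI ballI)
  show "set_pmf (succ_pmf credit_mdp s) \<subseteq> state (Suc (time s)) ` {..width (Suc (time s))}" for s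
    by (simp add: image_mono set_val_pmf)
qed auto

lemma finitely_branching_credit_mdp: "finitely_branching credit_mdp"
  by (simp add: finitely_branching_def succs_credit_mdp)

lemma integer_rewards_credit_mdp: "integer_rewards credit_mdp"
  by (simp add: integer_rewards_def)

lemma acyclic_credit_mdp: "acyclic (transitions credit_mdp)"
proof (rule acyclicI, rule allI)
  fix s
  have "(s, s') \<in> (transitions credit_mdp)\<^sup>+ \<Longrightarrow> time s < time s'" for s'
    by (induction rule: trancl_induct) auto
  then show "(s, s) \<notin> (transitions credit_mdp)\<^sup>+" by blast
qed

lemma emeasure_accident:
  assumes "time s = 4 * n + 3"
  shows "emeasure (measure_pmf (succ_pmf credit_mdp s)) {s'. val s' \<noteq> 0} = risk (level n) (val s)"
    and "emeasure (measure_pmf (succ_pmf credit_mdp s)) {s'. val s' = 0} = 1 - risk (level n) (val s)"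
proof -
  let ?f = "\<lambda>b. state (Suc (time s)) (of_bool b)"
  have m: "(4 * n + 3) mod 4 = 3" "(4 * n + 3) div 4 = n" by presburger+
  have *: "succ_pmf credit_mdp s = map_pmf ?f (bernoulli_pmf (risk (level n) (val s)))"
    unfolding credit_mdp_simps assms val_pmf_def m by (simp add: map_pmf_comp)
  have "?f -` {s'. val s' \<noteq> 0} = {True}" "?f -` {s'. val s' = 0} = {False}"
    by (auto simp: of_bool_def split: if_splits)
  then show "emeasure (measure_pmf (succ_pmf credit_mdp s)) {s'. val s' \<noteq> 0} = risk (level n) (val s)"
    "emeasure (measure_pmf (succ_pmf credit_mdp s)) {s'. val s' = 0} = 1 - risk (level n) (val s)"
    by (simp_all only: * measure_pmf.emeasure_eq_measure measure_map_pmf measure_pmf_single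
        pmf_bernoulli_True[OF risk_nonneg risk_le_1] pmf_bernoulli_False[OF risk_nonneg risk_le_1])
qed

lemma partial_run_time:
  assumes "partial_run credit_mdp h" "i < length h"
  shows "time (h ! i) = time (hd h) + i"
  using assms(2)
proof (induction i)
  case 0
  then show ?case by (simp add: hd_conv_nth)
next
  case (Suc i)
  then have "(h ! i, h ! Suc i) \<in> transitions credit_mdp"
    using assms(1) unfolding partial_run_def by blast
  with Suc show ?case by simp
qed

lemma step_counter_implicit_credit_mdp: "step_counter_implicit credit_mdp s"
proof -
  have *: "length h = Suc (time (last h) - time (hd h))" if "partial_run credit_mdp h" for h
  proof -
    have "h \<noteq> []" using that by (simp add: partial_run_def)
    then show ?thesis
      using partial_run_time[OF that, of "length h - 1"] by (simp add: last_conv_nth)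
  qed
  then show ?thesis
    unfolding step_counter_implicit_def by metis
qed

section \<open>Total reward along a run and the cost of failures\<close>

text \<open>Underpaying is not a failure in itself; it is penalised only through a higher risk of an
  accident.\<close>

definition failure :: "nat \<Rightarrow> (nat \<Rightarrow> nat) \<Rightarrow> bool" where
  "failure n \<rho> \<longleftrightarrow> val (\<rho> (4 * n + 1)) < val (\<rho> (4 * n + 3)) \<or> val (\<rho> (4 * n + 4)) \<noteq> 0"

definition total :: "(nat \<Rightarrow> nat) \<Rightarrow> nat \<Rightarrow> int" where
  "total \<rho> n = (\<Sum>j<n. credit_reward (\<rho> j, \<rho> (Suc j)))"

lemma runs_time_val:
  assumes "\<rho> \<in> runs credit_mdp (state 0 0)"
  shows "time (\<rho> t) = t" "val (\<rho> t) \<le> width t" "val (\<rho> 0) = 0"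
proof -
  have \<rho>: "\<rho> 0 = state 0 0" "\<And>j. time (\<rho> (Suc j)) = Suc (time (\<rho> j)) \<and> val (\<rho> (Suc j)) \<le> width (Suc (time (\<rho> j)))"
    using assms by (simp_all add: runs_def)
  show *: "time (\<rho> t) = t" for t
    by (induction t) (use \<rho> in auto)
  show "val (\<rho> 0) = 0" by (simp add: \<rho>)
  show "val (\<rho> t) \<le> width t"
    using \<rho>(1) \<rho>(2)[of "t - 1"] *[of t] *[of "t - 1"] by (cases t) auto
qed

lemma total_gadget:
  assumes "\<And>t. time (\<rho> t) = t"
  shows "total \<rho> (4 * n + 1) = total \<rho> (4 * n) + val (\<rho> (4 * n + 1)) * scale n
           + (if val (\<rho> (4 * n)) = 0 then 0 else scale n)"
    and "total \<rho> (4 * n + 2) = total \<rho> (4 * n + 1)"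
    and "total \<rho> (4 * n + 3) = total \<rho> (4 * n + 2) - val (\<rho> (4 * n + 3)) * scale n"
    and "total \<rho> (4 * n + 4) = total \<rho> (4 * n + 3)
           - (if val (\<rho> (4 * n + 4)) = 0 then 0 else scale (Suc n))"
proof -
  have 1: "total \<rho> (Suc t) = total \<rho> t + credit_reward (\<rho> t, \<rho> (Suc t))" for t
    by (simp add: total_def)
  have m: "(4 * n + 1) mod 4 = 1" "(4 * n + 2) mod 4 = 2" "(4 * n + 3) mod 4 = 3"
    "(4 * n + 1) div 4 = n" "(4 * n + 2) div 4 = n" "(4 * n + 3) div 4 = n"
    by presburger+
  have S: "Suc (4 * n) = 4 * n + 1" "Suc (4 * n + 1) = 4 * n + 2" "Suc (4 * n + 2) = 4 * n + 3"
    "Suc (4 * n + 3) = 4 * n + 4"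
    by simp_all
  note r = credit_reward_def assms m Let_def prod.case
  show "total \<rho> (4 * n + 1) = total \<rho> (4 * n) + val (\<rho> (4 * n + 1)) * scale n
           + (if val (\<rho> (4 * n)) = 0 then 0 else scale n)"
    unfolding 1[of "4 * n", unfolded S] r by simp
  show "total \<rho> (4 * n + 2) = total \<rho> (4 * n + 1)"
    unfolding 1[of "4 * n + 1", unfolded S] r by simp
  show "total \<rho> (4 * n + 3) = total \<rho> (4 * n + 2) - val (\<rho> (4 * n + 3)) * scale n"
    unfolding 1[of "4 * n + 2", unfolded S] r by simp
  show "total \<rho> (4 * n + 4) = total \<rho> (4 * n + 3)
           - (if val (\<rho> (4 * n + 4)) = 0 then 0 else scale (Suc n))"
    unfolding 1[of "4 * n + 3", unfolded S] r by simp
qed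

text \<open>Each accident loss cancels against its refund in the next gadget, so beyond the balance
  of credits and payments only an accident pending at time \<open>4 * n\<close> remains.\<close>

lemma total_gadget_start:
  assumes "\<And>t. time (\<rho> t) = t" "val (\<rho> 0) = 0"
  shows "total \<rho> (4 * n) =
    (\<Sum>g<n. (int (val (\<rho> (4 * g + 1))) - int (val (\<rho> (4 * g + 3)))) * scale g)
      - (if val (\<rho> (4 * n)) = 0 then 0 else scale n)"
proof (induction n)
  case 0
  then show ?case by (simp add: total_def assms)
next
  case (Suc n)
  have "4 * Suc n = 4 * n + 4" by simp
  then show ?case
    using Suc.IH total_gadget[OF assms(1), of n] by (simp add: algebra_simps)
qed

text \<open>All payments match and from gadget \<open>N\<close> on no refund is pending, so the
  total is \<open>0\<close> at each gadget start and equals the unspent credit in between.\<close>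

lemma total_nonneg:
  assumes \<rho>: "\<rho> \<in> runs credit_mdp (state 0 0)"
    and match: "\<And>n. val (\<rho> (4 * n + 3)) = val (\<rho> (4 * n + 1))"
    and safe: "\<And>n. N \<le> n \<Longrightarrow> val (\<rho> (4 * n)) = 0"
    and t: "4 * N \<le> t"
  shows "0 \<le> total \<rho> t"
proof -
  note tv = runs_time_val[OF \<rho>]
  define n where "n = t div 4"
  have n: "N \<le> n" using t by (auto simp: n_def)
  have 0: "total \<rho> (4 * n) = 0"
    using total_gadget_start[OF tv(1,3), of n] safe[OF n] match by simp
  have "t = 4 * n \<or> t = 4 * n + 1 \<or> t = 4 * n + 2 \<or> t = 4 * n + 3"
    unfolding n_def by presburger
  then show ?thesis
    using 0 total_gadget[OF tv(1), of n] match[of n] safe[OF n] by auto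
qed

text \<open>The best case is full credit and no payment in every earlier gadget, which
  \<open>scale_eq\<close> compares with \<open>scale n\<close>. The second summand anticipates the
  refund still due at time \<open>4 * n\<close>.\<close>

lemma total_le:
  assumes \<rho>: "\<rho> \<in> runs credit_mdp (state 0 0)"
  shows "total \<rho> (4 * n) + (if val (\<rho> (4 * n)) = 0 then 0 else scale n) \<le> int (scale n) - (4 * n + 4)"
proof -
  note tv = runs_time_val[OF \<rho>]
  have "(int (val (\<rho> (4 * g + 1))) - int (val (\<rho> (4 * g + 3)))) * scale g \<le> int (level g * scale g)" for g
  proof -
    have "(4 * g + 1) mod 4 = 1" "(4 * g + 1) div 4 = g" by presburger+
    then have "val (\<rho> (4 * g + 1)) \<le> level g"
      using tv(2)[of "4 * g + 1"] by (simp add: width_def)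
    then show ?thesis
      unfolding of_nat_mult by (intro mult_right_mono) auto
  qed
  then have "(\<Sum>g<n. (int (val (\<rho> (4 * g + 1))) - int (val (\<rho> (4 * g + 3)))) * scale g) \<le>
      (\<Sum>g<n. int (level g * scale g))"
    by (intro sum_mono)
  also have "\<dots> = int (scale n) - (4 * n + 4)"
    by (subst scale_eq) simp
  finally show ?thesis
    using total_gadget_start[OF tv(1,3), of n] by simp
qed

text \<open>Overpaying costs at least \<open>scale n\<close> net of the credit, and an accident
  costs \<open>scale (Suc n)\<close>. By \<open>total_le\<close> either loss exceeds all earlier
  gains by more than the elapsed time.\<close>

lemma failure_imp_total_le:
  assumes \<rho>: "\<rho> \<in> runs credit_mdp (state 0 0)" and f: "failure n \<rho>"
  shows "\<exists>t>4 * n. total \<rho> t \<le> - int t"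
proof -
  note tv = runs_time_val[OF \<rho>]
  from f consider "val (\<rho> (4 * n + 1)) < val (\<rho> (4 * n + 3))" | "val (\<rho> (4 * n + 4)) \<noteq> 0"
    by (auto simp: failure_def)
  then show ?thesis
  proof cases
    case 1
    then have "int (val (\<rho> (4 * n + 1))) + 1 \<le> int (val (\<rho> (4 * n + 3)))" by linarith
    then have "(int (val (\<rho> (4 * n + 1))) + 1) * int (scale n) \<le> int (val (\<rho> (4 * n + 3))) * int (scale n)"
      by (intro mult_right_mono) auto
    moreover have "(int (val (\<rho> (4 * n + 1))) + 1) * int (scale n) = int (val (\<rho> (4 * n + 1))) * int (scale n) + int (scale n)"
      by (simp add: algebra_simps)
    ultimately have "total \<rho> (4 * n + 3) \<le> - int (4 * n + 3)"
      using total_gadget[OF tv(1), of n] total_le[OF \<rho>, of n] by (simp split: if_splits)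
    then show ?thesis by (intro exI[of _ "4 * n + 3"]) simp
  next
    case 2
    have e: "4 * Suc n = 4 * n + 4" by simp
    have "total \<rho> (4 * n + 4) \<le> - int (4 * n + 4)"
      using 2 total_le[OF \<rho>, of "Suc n", unfolded e] by simp
    then show ?thesis by (intro exI[of _ "4 * n + 4"]) simp
  qed
qed

lemma mean_eq_total:
  "1 / real n * (\<Sum>j<n. reward credit_mdp (\<rho> j, \<rho> (Suc j))) = real_of_int (total \<rho> n) / n"
  by (simp add: total_def)

lemma MP_liminf_nonneg_if_total_nonneg:
  assumes "\<rho> \<in> runs credit_mdp s\<^sub>0" "\<And>t. N \<le> t \<Longrightarrow> 0 \<le> total \<rho> t"
  shows "\<rho> \<in> MP_liminf_nonneg credit_mdp s\<^sub>0"
proof -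
  have "0 \<le> liminf (\<lambda>n. ereal (real_of_int (total \<rho> n) / n))"
    using assms(2) by (intro Liminf_bounded eventually_sequentiallyI[of N]) auto
  with assms(1) show ?thesis
    unfolding MP_liminf_nonneg_def mean_eq_total by blast
qed

lemma MP_liminf_nonneg_imp_finite_failures:
  assumes "\<rho> \<in> MP_liminf_nonneg credit_mdp (state 0 0)"
  shows "\<exists>N. \<forall>n\<ge>N. \<not> failure n \<rho>"
proof -
  have \<rho>: "\<rho> \<in> runs credit_mdp (state 0 0)"
    and "ereal (-1) < liminf (\<lambda>n. ereal (real_of_int (total \<rho> n) / n))"
    using assms unfolding MP_liminf_nonneg_def mean_eq_total
    by (auto intro: less_le_trans[of _ 0])
  from less_LiminfD[OF this(2)] obtain N where N: "\<And>n. N \<le> n \<Longrightarrow> -1 < real_of_int (total \<rho> n) / n"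
    by (auto simp: eventually_sequentially)
  have "\<not> failure n \<rho>" if "N \<le> n" for n
  proof
    assume "failure n \<rho>"
    then obtain t where t: "4 * n < t" "total \<rho> t \<le> - int t"
      using failure_imp_total_le[OF \<rho>] by blast
    then have "-1 < real_of_int (total \<rho> t) / t" using that N by simp
    then have "- real t < real_of_int (total \<rho> t)" using t(1) by (simp add: field_simps)
    with t(2) show False by linarith
  qed
  then show ?thesis by blast
qed

section \<open>Matching the credit\<close>

lemma hist_pmf_support:
  assumes wf: "wf_mdp M" and \<sigma>: "strategy M \<sigma>" and s: "s\<^sub>0 \<in> states M"
  shows "h \<in> set_pmf (hist_pmf M s\<^sub>0 \<sigma> n) \<Longrightarrow> partial_run M h \<and> hd h = s\<^sub>0"
proof (induction n arbitrary: h)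
  case 0
  with s show ?case by (simp add: partial_run_def)
next
  case (Suc n)
  then obtain h' s' where h': "h' \<in> set_pmf (hist_pmf M s\<^sub>0 \<sigma> n)"
    and s': "s' \<in> set_pmf (next_pmf M \<sigma> h')" and h: "h = h' @ [s']"
    by auto
  from Suc.IH[OF h'] have pr: "partial_run M h'" "hd h' = s\<^sub>0" by auto
  then have ne: "h' \<noteq> []" by (simp add: partial_run_def)
  with pr have "last h' \<in> states M" by (auto simp: partial_run_def)
  then have "(last h', s') \<in> transitions M"
    using s' pr(1) \<sigma> wf by (auto simp: next_pmf_def strategy_def wf_mdp_def succs_def states_def split: if_splits)
  moreover have "s' \<in> states M" using calculation wf by (auto simp: wf_mdp_def)
  ultimately show ?case
    using pr ne unfolding h by (auto intro!: partial_run_snoc)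
qed

lemma nn_integral_hist_pmf_Suc:
  "(\<integral>\<^sup>+h. f h \<partial>measure_pmf (hist_pmf M s\<^sub>0 \<sigma> (Suc n))) =
     (\<integral>\<^sup>+h. \<integral>\<^sup>+s. f (h @ [s]) \<partial>measure_pmf (next_pmf M \<sigma> h) \<partial>measure_pmf (hist_pmf M s\<^sub>0 \<sigma> n))"
  by simp

lemma run_in_runs:
  assumes wf: "wf_mdp M" and \<sigma>: "strategy M \<sigma>" and s: "s\<^sub>0 \<in> states M"
    and \<rho>: "\<And>n. map \<rho> [0..<Suc n] \<in> set_pmf (hist_pmf M s\<^sub>0 \<sigma> n)"
  shows "\<rho> \<in> runs M s\<^sub>0"
proof -
  have pr: "partial_run M (map \<rho> [0..<Suc n])" "hd (map \<rho> [0..<Suc n]) = s\<^sub>0" for n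
    using hist_pmf_support[OF wf \<sigma> s \<rho>] by auto
  have "\<rho> 0 = s\<^sub>0" using pr(2)[of 0] by simp
  moreover have "(\<rho> j, \<rho> (Suc j)) \<in> transitions M" for j
  proof -
    have "map \<rho> [0..<Suc (Suc j)] ! j = \<rho> j" "map \<rho> [0..<Suc (Suc j)] ! Suc j = \<rho> (Suc j)"
      by (simp_all only: nth_map_upt add_0 diff_zero lessI less_SucI)
    then show ?thesis
      using pr(1)[of "Suc j"] unfolding partial_run_def by (metis diff_zero length_map length_upt lessI)
  qed
  ultimately show ?thesis by (simp add: runs_def)
qed

section \<open>The winning strategy\<close>

text \<open>At the payment time \<open>4 * n + 2\<close> a history from time 0 has length
  \<open>4 * n + 3\<close>, so the index is the time \<open>4 * n + 1\<close> of the draw. The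
  minimum keeps the choice legal on partial runs with another start.\<close>

definition match_strategy :: "nat list \<Rightarrow> nat pmf" where
  "match_strategy h = (let t = Suc (time (last h)) in
     return_pmf (state t (min (width t) (val (h ! (length h - 2))))))"

lemma strategy_match_strategy: "strategy credit_mdp match_strategy"
  by (simp add: strategy_def match_strategy_def Let_def succs_credit_mdp)

lemma credit_hist_time:
  assumes "strategy credit_mdp \<sigma>" "h \<in> set_pmf (hist_pmf credit_mdp (state 0 0) \<sigma> n)"
  shows "time (last h) = n"
proof -
  note hs = hist_pmf_support[OF wf_credit_mdp assms(1) _ assms(2), simplified]
  note l = hist_pmf_length[OF assms(2)]
  then have "h \<noteq> []" by auto
  with l partial_run_time[of h n] hs show ?thesis by (simp add: last_conv_nth)
qed

lemma match_hist:
  assumes h: "h \<in> set_pmf (hist_pmf credit_mdp (state 0 0) match_strategy (4 * n + 3))"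
  shows "val (h ! (4 * n + 3)) = val (h ! (4 * n + 1))"
proof -
  have S: "4 * n + 3 = Suc (4 * n + 2)" by simp
  from h obtain h' s' where h': "h' \<in> set_pmf (hist_pmf credit_mdp (state 0 0) match_strategy (4 * n + 2))"
    and s': "s' \<in> set_pmf (next_pmf credit_mdp match_strategy h')" and hh: "h = h' @ [s']"
    unfolding S hist_pmf.simps(2) set_bind_pmf set_map_pmf by blast
  note len = hist_pmf_length[OF h']
  have t: "time (last h') = 4 * n + 2"
    by (rule credit_hist_time[OF strategy_match_strategy h'])
  have pr: "partial_run credit_mdp h'"
    using hist_pmf_support[OF wf_credit_mdp strategy_match_strategy _ h'] by simp
  have "(h' ! (4 * n), h' ! (Suc (4 * n))) \<in> transitions credit_mdp"
    using pr len unfolding partial_run_def by simp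
  moreover have "time (h' ! (4 * n)) = 4 * n"
    using partial_run_time[OF pr, of "4 * n"] len
      hist_pmf_support[OF wf_credit_mdp strategy_match_strategy _ h'] by simp
  \<comment> \<open>Makes the minimum in the strategy inactive: the drawn level is within the width
    at the payment.\<close>
  ultimately have "val (h' ! (4 * n + 1)) \<le> width (4 * n + 1)"
    by auto
  moreover have "width (4 * n + 1) = level n" "width (4 * n + 3) = level n"
  proof -
    have "(4 * n + 1) mod 4 = 1" "(4 * n + 3) mod 4 = 3" "(4 * n + 1) div 4 = n" "(4 * n + 3) div 4 = n"
      by presburger+
    then show "width (4 * n + 1) = level n" "width (4 * n + 3) = level n"
      by (simp_all only: width_def) simp_all
  qed
  moreover have "(4 * n + 2) mod 4 = 2" by presburger
  then have "s' \<in> set_pmf (match_strategy h')"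
    using s' t by (simp add: next_pmf_def)
  then have "val s' = min (width (4 * n + 3)) (val (h' ! (4 * n + 1)))"
    using t len by (simp add: match_strategy_def Let_def numeral_3_eq_3)
  ultimately show ?thesis using len by (simp add: hh nth_append)
qed

text \<open>Integrates backwards through the gadget: an accident has the risk of the paid level,
  which is the drawn one; payment and merge leave that value untouched; averaging over the draw
  gives \<open>match_risk\<close>.\<close>

lemma emeasure_match_accident:
  "emeasure (measure_pmf (hist_pmf credit_mdp (state 0 0) match_strategy (4 * n + 4)))
     {h. val (h ! (4 * n + 4)) \<noteq> 0} = match_risk n"
proof -
  let ?H = "\<lambda>t. measure_pmf (hist_pmf credit_mdp (state 0 0) match_strategy t)"
  let ?next = "\<lambda>h. measure_pmf (next_pmf credit_mdp match_strategy h)"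
  note time = credit_hist_time[OF strategy_match_strategy]
  have S: "4 * n + 4 = Suc (4 * n + 3)" "4 * n + 3 = Suc (4 * n + 2)" "4 * n + 2 = Suc (4 * n + 1)"
    "4 * n + 1 = Suc (4 * n)" by simp_all
  let ?r = "\<lambda>h. ennreal (risk (level n) (val (h ! (4 * n + 1))))"
  have "emeasure (?H (4 * n + 4)) {h. val (h ! (4 * n + 4)) \<noteq> 0} =
      (\<integral>\<^sup>+h. indicator {h. val (h ! (4 * n + 4)) \<noteq> 0} h \<partial>?H (4 * n + 4))"
    by simp
  also have "\<dots> = (\<integral>\<^sup>+h. \<integral>\<^sup>+s. indicator {h. val (h ! (4 * n + 4)) \<noteq> 0} (h @ [s]) \<partial>?next h \<partial>?H (4 * n + 3))"
    unfolding S(1) by (rule nn_integral_hist_pmf_Suc)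
  also have "\<dots> = (\<integral>\<^sup>+h. ?r h \<partial>?H (4 * n + 3))"
  proof (intro nn_integral_cong_AE, unfold AE_measure_pmf_iff, intro ballI)
    fix h assume h: "h \<in> set_pmf (hist_pmf credit_mdp (state 0 0) match_strategy (4 * n + 3))"
    note t = time[OF h] and len = hist_pmf_length[OF h]
    have m: "(4 * n + 3) mod 4 = 3" by presburger
    have "(\<integral>\<^sup>+s. indicator {h. val (h ! (4 * n + 4)) \<noteq> 0} (h @ [s]) \<partial>?next h) =
        (\<integral>\<^sup>+s. indicator {s. val s \<noteq> 0} s \<partial>?next h)"
      using len by (intro nn_integral_cong) (auto simp: indicator_def nth_append)
    also have "\<dots> = emeasure (succ_pmf credit_mdp (last h)) {s. val s \<noteq> 0}"
    proof -
      have "next_pmf credit_mdp match_strategy h = succ_pmf credit_mdp (last h)"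
        unfolding next_pmf_def using t m by simp
      then show ?thesis by (simp only: nn_integral_indicator sets_measure_pmf UNIV_I)
    qed
    also have "\<dots> = risk (level n) (val (last h))"
      by (rule emeasure_accident(1)[OF t])
    also have "val (last h) = val (h ! (4 * n + 3))"
    proof -
      have ne: "h \<noteq> []" and l: "length h - 1 = 4 * n + 3" using len by auto
      show ?thesis by (simp only: last_conv_nth[OF ne] l)
    qed
    finally show "(\<integral>\<^sup>+s. indicator {h. val (h ! (4 * n + 4)) \<noteq> 0} (h @ [s]) \<partial>?next h) = ?r h"
      unfolding match_hist[OF h] .
  qed
  also have "\<dots> = (\<integral>\<^sup>+h. ?r h \<partial>?H (4 * n + 2))"
    unfolding S(2) nn_integral_hist_pmf_Suc
  proof (intro nn_integral_cong_AE, unfold AE_measure_pmf_iff, intro ballI)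
    fix h assume "h \<in> set_pmf (hist_pmf credit_mdp (state 0 0) match_strategy (4 * n + 2))"
    from hist_pmf_length[OF this]
    show "(\<integral>\<^sup>+s. ?r (h @ [s]) \<partial>?next h) = ?r h"
      by (simp add: nth_append)
  qed
  also have "\<dots> = (\<integral>\<^sup>+h. ?r h \<partial>?H (4 * n + 1))"
    unfolding S(3) nn_integral_hist_pmf_Suc
  proof (intro nn_integral_cong_AE, unfold AE_measure_pmf_iff, intro ballI)
    fix h assume "h \<in> set_pmf (hist_pmf credit_mdp (state 0 0) match_strategy (4 * n + 1))"
    from hist_pmf_length[OF this]
    show "(\<integral>\<^sup>+s. ?r (h @ [s]) \<partial>?next h) = ?r h"
      by (simp add: nth_append)
  qed
  also have "\<dots> = (\<integral>\<^sup>+h. match_risk n \<partial>?H (4 * n))"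
    unfolding S(4) nn_integral_hist_pmf_Suc
  proof (intro nn_integral_cong_AE, unfold AE_measure_pmf_iff, intro ballI)
    fix h assume h: "h \<in> set_pmf (hist_pmf credit_mdp (state 0 0) match_strategy (4 * n))"
    note t = time[OF h] and len = hist_pmf_length[OF h]
    have "(\<integral>\<^sup>+s. ennreal (risk (level n) (val ((h @ [s]) ! Suc (4 * n)))) \<partial>?next h) =
        (\<integral>\<^sup>+i. ennreal (risk (level n) i) \<partial>level_pmf (level n))"
      using t len by (simp add: next_pmf_def val_pmf_def nth_append)
    also have "\<dots> = (\<Sum>i\<le>level n. ennreal (risk (level n) i) * ennreal (pmf (level_pmf (level n)) i))"
      by (subst nn_integral_measure_pmf_finite) (simp_all add: set_level_pmf)
    also have "\<dots> = ennreal (\<Sum>i\<le>level n. pmf (level_pmf (level n)) i * risk (level n) i)"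
      by (subst sum_ennreal[symmetric]) (auto simp: risk_nonneg ennreal_mult mult.commute)
    also have "\<dots> = match_risk n" by (simp only: expected_match_risk)
    finally show "(\<integral>\<^sup>+s. ennreal (risk (level n) (val ((h @ [s]) ! Suc (4 * n)))) \<partial>?next h) = match_risk n" .
  qed
  also have "\<dots> = match_risk n" by simp
  finally show ?thesis .
qed

lemma measure_match_strategy:
  "measure (run_measure credit_mdp (state 0 0) match_strategy) (MP_liminf_nonneg credit_mdp (state 0 0)) = 1"
proof -
  let ?P = "run_measure credit_mdp (state 0 0) match_strategy"
  interpret prob_space ?P by (rule prob_space_run_measure)
  define A where "A n = {\<rho>. map \<rho> [0..<Suc (4 * n + 4)] \<in> {h. val (h ! (4 * n + 4)) \<noteq> 0}}" for n
  have A: "A n = {\<rho>. val (\<rho> (4 * n + 4)) \<noteq> 0}" for n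
  proof -
    have "map \<rho> [0..<Suc (4 * n + 4)] ! (4 * n + 4) = \<rho> (4 * n + 4)" for \<rho> :: "nat \<Rightarrow> nat"
      by (simp only: nth_map_upt add_0 diff_zero lessI)
    then show ?thesis by (simp only: A_def mem_Collect_eq)
  qed
  have meas: "A n \<in> sets ?P" for n
    unfolding A_def by (rule prefix_event_in_sets)
  have em: "emeasure ?P (A n) = match_risk n" for n
    unfolding A_def emeasure_run_measure_prefix by (rule emeasure_match_accident)
  have prob: "measure ?P (A n) = match_risk n" for n
    using em[of n] by (simp add: measure_def match_risk_def)
  have "AE \<rho> in ?P. eventually (\<lambda>n. \<rho> \<in> space ?P - A n) sequentially"
    by (intro borel_cantelli_AE1 meas) (simp_all add: em prob summable_match_risk)
  with AE_prefix_in_hist_pmf have "AE \<rho> in ?P. \<rho> \<in> MP_liminf_nonneg credit_mdp (state 0 0)"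
  proof eventually_elim
    case (elim \<rho>)
    then have pre: "\<And>n. map \<rho> [0..<Suc n] \<in> set_pmf (hist_pmf credit_mdp (state 0 0) match_strategy n)"
      by blast
    have \<rho>: "\<rho> \<in> runs credit_mdp (state 0 0)"
      by (rule run_in_runs[OF wf_credit_mdp strategy_match_strategy _ pre]) simp
    from elim obtain N where N: "\<And>n. N \<le> n \<Longrightarrow> val (\<rho> (4 * n + 4)) = 0"
      by (auto simp: A eventually_sequentially)
    have match: "val (\<rho> (4 * n + 3)) = val (\<rho> (4 * n + 1))" for n
    proof -
      have "map \<rho> [0..<Suc (4 * n + 3)] ! i = \<rho> i" if "i \<le> 4 * n + 3" for i
        using that by (simp only: nth_map_upt add_0 diff_zero less_Suc_eq_le)
      then have "map \<rho> [0..<Suc (4 * n + 3)] ! (4 * n + 3) = \<rho> (4 * n + 3)"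
        "map \<rho> [0..<Suc (4 * n + 3)] ! (4 * n + 1) = \<rho> (4 * n + 1)"
        by simp_all
      then show ?thesis using match_hist[OF pre] by metis
    qed
    \<comment> \<open>The accident of gadget \<open>n\<close> is recorded at time
      \<open>4 * Suc n\<close>, hence the shift.\<close>
    have safe: "val (\<rho> (4 * n)) = 0" if "Suc N \<le> n" for n
      using that N[of "n - 1"] by (cases n) (auto simp: add.commute)
    show ?case
      using total_nonneg[OF \<rho> match safe] by (intro MP_liminf_nonneg_if_total_nonneg[OF \<rho>])
  qed
  then show ?thesis
    by (subst prob_eq_1[OF MP_liminf_nonneg_in_sets])
qed

section \<open>Bounded memory\<close>

lemma level_pmf_ge:
  assumes "i \<le> k"
  shows "1 / block_length k \<le> pmf (level_pmf k) i"
  using assms by (auto simp: pmf_level_pmf intro!: divide_right_mono one_le_power simp: Suc_leI)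

text \<open>For \<open>i < j\<close> the factor \<open>base k ^ j\<close> in the probability of
  \<open>j\<close> absorbs the \<open>base k ^ (i + 1)\<close> in the risk of
  \<open>i\<close>.\<close>

lemma level_pmf_times_risk_ge:
  assumes "i < j" "j \<le> k"
  shows "1 / block_length k \<le> pmf (level_pmf k) j * risk k i"
proof -
  have "real (base k) ^ (i + 1) \<le> real (base k) ^ j"
    using assms by (intro power_increasing) (auto simp: Suc_leI)
  then have "1 \<le> real (base k) ^ j / real (base k) ^ (i + 1)"
    by (subst le_divide_eq_1_pos) (auto simp: Suc_leI)
  then have "1 / block_length k \<le> (real (base k) ^ j / real (base k) ^ (i + 1)) / block_length k"
    by (intro divide_right_mono) auto
  also have "\<dots> = pmf (level_pmf k) j * risk k i"
    using assms by (simp add: pmf_level_pmf risk_def)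
  finally show ?thesis .
qed

text \<open>Level \<open>i\<close> is the one drawn, level \<open>j\<close> the one paid for.\<close>

definition failure_prob :: "nat \<Rightarrow> nat \<Rightarrow> nat \<Rightarrow> real" where
  "failure_prob k i j = (if i < j then 1 else risk k j)"

lemma failure_prob_bounds: "0 \<le> failure_prob k i j" "failure_prob k i j \<le> 1"
  by (simp_all add: failure_prob_def risk_nonneg risk_le_1)

text \<open>
  Two levels \<open>i < i'\<close> must share a memory mode. In this mode, paying for more than \<open>i\<close> fails if \<open>i\<close>
  was drawn, and paying for at most \<open>i\<close> is needlessly risky if \<open>i'\<close> was drawn.
\<close>

lemma failure_pigeonhole:
  fixes J :: "(nat \<times> 'm) pmf" and p :: "'m \<Rightarrow> nat pmf"
  assumes J: "map_pmf fst J = level_pmf k" and Q: "snd ` set_pmf J \<subseteq> Q" "finite Q" "card Q \<le> q"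
    and q: "0 < q" "q \<le> k"
  shows "ennreal (1 / (q * block_length k)) \<le>
    (\<integral>\<^sup>+x. \<integral>\<^sup>+j. failure_prob k (fst x) j \<partial>measure_pmf (p (snd x)) \<partial>measure_pmf J)"
proof -
  let ?c = "1 / (real q * block_length k)"
  \<comment> \<open>Some mode carries at least a \<open>1 / q\<close> share of level
    \<open>i\<close>; otherwise the at most \<open>q\<close> modes could not add up to its
    probability.\<close>
  have "\<exists>m\<in>Q. pmf (level_pmf k) i / q \<le> pmf J (i, m)" if "i \<le> k" for i
  proof (rule ccontr)
    assume "\<not> ?thesis"
    then have less: "pmf J (i, m) < pmf (level_pmf k) i / q" if "m \<in> Q" for m
      using that by force
    have "pmf (level_pmf k) i = measure J (fst -` {i})"
      unfolding J[symmetric] by (simp add: pmf_map)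
    also have "\<dots> = measure J (Pair i ` Q)"
      using Q(1) by (intro measure_pmf.finite_measure_eq_AE) (force simp: AE_measure_pmf_iff)+
    also have "\<dots> = (\<Sum>m\<in>Q. pmf J (i, m))"
      using Q(2) by (subst measure_measure_pmf_finite) (auto simp: sum.reindex inj_on_def)
    finally have eq: "pmf (level_pmf k) i = (\<Sum>m\<in>Q. pmf J (i, m))" .
    have pos: "0 < pmf (level_pmf k) i"
      using that by (simp add: pmf_positive set_level_pmf)
    then have ne: "Q \<noteq> {}" using eq by auto
    have "pmf (level_pmf k) i < (\<Sum>m\<in>Q. pmf (level_pmf k) i / q)"
      unfolding eq[symmetric] using sum_strict_mono[OF Q(2) ne less] eq by simp
    also have "\<dots> = card Q * (pmf (level_pmf k) i / q)" by simp
    also have "\<dots> \<le> q * (pmf (level_pmf k) i / q)"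
      using Q(3) pos by (intro mult_right_mono) auto
    also have "\<dots> = pmf (level_pmf k) i" using q by simp
    finally show False by simp
  qed
  then obtain f where f: "\<And>i. i \<le> k \<Longrightarrow> f i \<in> Q \<and> pmf (level_pmf k) i / q \<le> pmf J (i, f i)"
    by metis
  have "card (f ` {..k}) \<le> card Q" using f Q(2) by (intro card_mono) auto
  \<comment> \<open>There are \<open>k + 1 > q\<close> levels but at most \<open>q\<close>
    modes.\<close>
  then have "\<not> inj_on f {..k}" using Q(3) q card_image[of f "{..k}"] by auto
  then obtain a b where "a \<le> k" "b \<le> k" "a \<noteq> b" "f a = f b"
    by (auto simp: inj_on_def)
  then obtain i i' where i: "i < i'" "i' \<le> k" "f i' = f i"
    by (metis linorder_neqE_nat)
  let ?F = "\<lambda>x. \<integral>\<^sup>+j. failure_prob k (fst x) j \<partial>measure_pmf (p (snd x))"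
  let ?x = "(i, f i)" and ?x' = "(i', f i)"
  have Ji: "?c \<le> pmf J ?x"
  proof -
    have "?c = (1 / block_length k) / q" by simp
    also have "\<dots> \<le> pmf (level_pmf k) i / q"
      using i by (intro divide_right_mono level_pmf_ge) auto
    also have "\<dots> \<le> pmf J ?x" using f[of i] i by simp
    finally show ?thesis .
  qed
  have Ji': "?c \<le> pmf J ?x' * risk k i"
  proof -
    have "?c = (1 / block_length k) / q" by simp
    also have "\<dots> \<le> (pmf (level_pmf k) i' * risk k i) / q"
      using i by (intro divide_right_mono level_pmf_times_risk_ge) auto
    also have "\<dots> = (pmf (level_pmf k) i' / q) * risk k i" by simp
    also have "\<dots> \<le> pmf J ?x' * risk k i"
      using f[of i'] i by (intro mult_right_mono risk_nonneg) auto
    finally show ?thesis .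
  qed
  \<comment> \<open>One payment law serves both levels, because it depends on the shared mode
    only.\<close>
  let ?P = "measure_pmf (p (f i))"
  have F: "emeasure ?P {i<..} \<le> ?F ?x"
  proof -
    have "emeasure ?P {i<..} = (\<integral>\<^sup>+j. indicator {i<..} j \<partial>?P)" by simp
    also have "\<dots> \<le> ?F ?x"
      unfolding fst_conv snd_conv by (intro nn_integral_mono) (auto simp: indicator_def failure_prob_def)
    finally show ?thesis .
  qed
  have F': "ennreal (risk k i) * emeasure ?P {..i} \<le> ?F ?x'"
  proof -
    have "ennreal (risk k i) * emeasure ?P {..i} = (\<integral>\<^sup>+j. ennreal (risk k i) * indicator {..i} j \<partial>?P)"
      by (subst nn_integral_cmult_indicator) auto
    also have "\<dots> \<le> ?F ?x'"
      unfolding fst_conv snd_conv using i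
      by (intro nn_integral_mono) (auto simp: indicator_def failure_prob_def risk_antimono ennreal_leI)
    finally show ?thesis .
  qed
  have "{i<..} \<union> {..i} = UNIV" by auto
  then have "emeasure ?P {i<..} + emeasure ?P {..i} = emeasure ?P UNIV"
    by (subst plus_emeasure) auto
  then have one: "emeasure ?P {i<..} + emeasure ?P {..i} = 1"
    using measure_pmf.emeasure_space_1[of "p (f i)"] by simp
  \<comment> \<open>The payment is either above \<open>i\<close> or at most \<open>i\<close>. Each
    event has weight at least \<open>?c\<close>: the first when \<open>i\<close> was drawn, the
    second, through the risk, when \<open>i'\<close> was.\<close>
  have "ennreal ?c = ennreal ?c * (emeasure ?P {i<..} + emeasure ?P {..i})"
    by (simp only: one mult_1_right)
  also have "\<dots> = ennreal ?c * emeasure ?P {i<..} + ennreal ?c * emeasure ?P {..i}"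
    by (simp add: distrib_left)
  also have "\<dots> \<le> ennreal (pmf J ?x) * emeasure ?P {i<..} + ennreal (pmf J ?x' * risk k i) * emeasure ?P {..i}"
    using Ji Ji' by (intro add_mono mult_right_mono ennreal_leI) auto
  also have "\<dots> = ennreal (pmf J ?x) * emeasure ?P {i<..} + ennreal (pmf J ?x') * (ennreal (risk k i) * emeasure ?P {..i})"
    by (simp add: ennreal_mult risk_nonneg mult.assoc)
  also have "\<dots> \<le> ennreal (pmf J ?x) * ?F ?x + ennreal (pmf J ?x') * ?F ?x'"
    using F F' by (intro add_mono mult_left_mono) auto
  also have "\<dots> = (\<Sum>x\<in>{?x, ?x'}. ?F x * ennreal (pmf J x))"
    using i by (simp add: mult.commute)
  also have "\<dots> = (\<integral>\<^sup>+x. ?F x * indicator {?x, ?x'} x \<partial>measure_pmf J)"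
    by (subst nn_integral_indicator_finite) (auto simp: emeasure_pmf_single)
  also have "\<dots> \<le> (\<integral>\<^sup>+x. ?F x \<partial>measure_pmf J)"
    by (intro nn_integral_mono) (auto simp: indicator_def)
  finally show ?thesis by simp
qed

text \<open>Survival probabilities are the factors multiplied later. The bound follows because the
  survival and failure integrals add up to \<open>1\<close>.\<close>

lemma no_failure_pigeonhole:
  fixes J :: "(nat \<times> 'm) pmf" and p :: "'m \<Rightarrow> nat pmf"
  assumes J: "map_pmf fst J = level_pmf k" and Q: "snd ` set_pmf J \<subseteq> Q" "finite Q" "card Q \<le> q"
    and q: "0 < q" "q \<le> k"
  shows "(\<integral>\<^sup>+x. \<integral>\<^sup>+j. 1 - failure_prob k (fst x) j \<partial>measure_pmf (p (snd x)) \<partial>measure_pmf J) \<le>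
    ennreal (1 - 1 / (q * block_length k))"
proof -
  let ?c = "1 / (q * block_length k)"
  let ?E = "\<lambda>g. \<integral>\<^sup>+x. \<integral>\<^sup>+j. ennreal (g (fst x) j) \<partial>measure_pmf (p (snd x)) \<partial>measure_pmf J"
  have pt: "ennreal (1 - failure_prob k i j) + ennreal (failure_prob k i j) = 1" for i j
    using failure_prob_bounds[of k i j] by (subst ennreal_plus[symmetric]) auto
  have "?E (\<lambda>i j. 1 - failure_prob k i j) + ?E (failure_prob k) =
      (\<integral>\<^sup>+x. (\<integral>\<^sup>+j. ennreal (1 - failure_prob k (fst x) j) \<partial>measure_pmf (p (snd x))) +
        (\<integral>\<^sup>+j. ennreal (failure_prob k (fst x) j) \<partial>measure_pmf (p (snd x))) \<partial>measure_pmf J)"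
    by (rule nn_integral_add[symmetric]) auto
  also have "\<dots> = (\<integral>\<^sup>+x. \<integral>\<^sup>+j. ennreal (1 - failure_prob k (fst x) j) + ennreal (failure_prob k (fst x) j)
        \<partial>measure_pmf (p (snd x)) \<partial>measure_pmf J)"
    by (intro nn_integral_cong nn_integral_add[symmetric]) auto
  also have "\<dots> = 1"
    by (simp only: pt) simp
  finally have sum: "?E (\<lambda>i j. 1 - failure_prob k i j) + ?E (failure_prob k) = 1" .
  have "?E (\<lambda>i j. 1 - failure_prob k i j) + ennreal ?c \<le>
      ?E (\<lambda>i j. 1 - failure_prob k i j) + ?E (failure_prob k)"
    by (intro add_left_mono failure_pigeonhole[OF assms])
  then have "?E (\<lambda>i j. 1 - failure_prob k i j) + ennreal ?c \<le> 1"
    unfolding sum .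
  then have "?E (\<lambda>i j. 1 - failure_prob k i j) \<le> 1 - ennreal ?c"
    unfolding ennreal_le_minus_iff by blast
  also have "\<dots> = ennreal (1 - ?c)"
    using ennreal_minus[of ?c 1] by (simp only: ennreal_1) simp
  finally show ?thesis .
qed

text \<open>The merged state at time \<open>4 * n + 2\<close> hides the level, so the payment law is
  a function of the mode, and the pigeonhole applies to the joint law \<open>?J\<close> of drawn
  level and mode. The bound is uniform in the initial mode \<open>m\<close>.\<close>

lemma gadget_bound:
  fixes Q :: "nat \<Rightarrow> 'm set"
  assumes \<tau>: "timed_update credit_mdp Q \<tau>" and Q: "\<And>n. finite (Q n)" "\<And>n. card (Q n) \<le> q"
    and q: "0 < q" "q \<le> level n" and m: "m \<in> Q (4 * n)" and s: "time s = 4 * n"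
  shows "(\<integral>\<^sup>+p\<^sub>1. \<integral>\<^sup>+p\<^sub>2. \<integral>\<^sup>+p\<^sub>3. \<integral>\<^sup>+p\<^sub>4. indicator {p. val (snd p\<^sub>3) \<le> val (snd p\<^sub>1) \<and> val (snd p) = 0} p\<^sub>4
      \<partial>measure_pmf (\<tau> (fst p\<^sub>3) (snd p\<^sub>3)) \<partial>measure_pmf (\<tau> (fst p\<^sub>2) (snd p\<^sub>2))
      \<partial>measure_pmf (\<tau> (fst p\<^sub>1) (snd p\<^sub>1)) \<partial>measure_pmf (\<tau> m s)) \<le>
    ennreal (1 - 1 / (q * block_length (level n)))"
proof -
  let ?k = "level n"
  let ?p = "\<lambda>m. map_pmf (\<lambda>p. val (snd p)) (\<tau> m (state (4 * n + 2) 0))"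
  let ?J = "bind_pmf (\<tau> m s) (\<lambda>p\<^sub>1. map_pmf (\<lambda>p\<^sub>2. (val (snd p\<^sub>1), fst p\<^sub>2)) (\<tau> (fst p\<^sub>1) (snd p\<^sub>1)))"
  have mods: "(4 * n) mod 4 = 0" "(4 * n) div 4 = n" "(4 * n + 1) mod 4 = 1" "(4 * n + 3) mod 4 = 3"
    by presburger+
  have step: "fst p' \<in> Q (Suc t) \<and> time (snd p') = Suc (time s)"
    if "p' \<in> set_pmf (\<tau> m s)" "m \<in> Q t" for p' m s t
    using timed_update_step[OF wf_credit_mdp \<tau> that(2), of s "fst p'" "snd p'"] that(1) by simp
  have rand: "map_pmf snd (\<tau> m s) = succ_pmf credit_mdp s" if "m \<in> Q t" "time s mod 4 \<noteq> 2" for m s t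
    using \<tau> that unfolding timed_update_def by (metis credit_mdp_simps(2))
  have S1: "fst p\<^sub>1 \<in> Q (4 * n + 1) \<and> time (snd p\<^sub>1) = 4 * n + 1" if "p\<^sub>1 \<in> set_pmf (\<tau> m s)" for p\<^sub>1
    using step[OF that m] s by simp
  have S2: "fst p\<^sub>2 \<in> Q (4 * n + 2) \<and> snd p\<^sub>2 = state (4 * n + 2) 0"
    if "p\<^sub>1 \<in> set_pmf (\<tau> m s)" "p\<^sub>2 \<in> set_pmf (\<tau> (fst p\<^sub>1) (snd p\<^sub>1))" for p\<^sub>1 p\<^sub>2
  proof
    note p1 = S1[OF that(1)]
    show "fst p\<^sub>2 \<in> Q (4 * n + 2)"
      using step[OF that(2), of "4 * n + 1"] p1 by simp
    have "snd p\<^sub>2 \<in> set_pmf (map_pmf snd (\<tau> (fst p\<^sub>1) (snd p\<^sub>1)))"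
      using that(2) by simp
    also have "map_pmf snd (\<tau> (fst p\<^sub>1) (snd p\<^sub>1)) = succ_pmf credit_mdp (snd p\<^sub>1)"
      using p1 mods by (intro rand[of _ "4 * n + 1"]) auto
    also have "\<dots> = return_pmf (state (4 * n + 2) 0)"
      using p1 mods(3) by (simp add: val_pmf_def)
    finally show "snd p\<^sub>2 = state (4 * n + 2) 0" by simp
  qed
  \<comment> \<open>Overpaying leaves no chance of survival; otherwise only the accident matters,
    whose law the MDP fixes.\<close>
  have last: "(\<integral>\<^sup>+p\<^sub>4. indicator {p. val (snd p\<^sub>3) \<le> i \<and> val (snd p) = 0} p\<^sub>4 \<partial>measure_pmf (\<tau> (fst p\<^sub>3) (snd p\<^sub>3))) =
      ennreal (1 - failure_prob ?k i (val (snd p\<^sub>3)))"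
    if "m\<^sub>2 \<in> Q (4 * n + 2)" "p\<^sub>3 \<in> set_pmf (\<tau> m\<^sub>2 (state (4 * n + 2) 0))" for m\<^sub>2 p\<^sub>3 i
  proof (cases "val (snd p\<^sub>3) \<le> i")
    case True
    have p3: "fst p\<^sub>3 \<in> Q (4 * n + 3)" "time (snd p\<^sub>3) = 4 * n + 3"
      using step[OF that(2,1)] by (simp_all add: numeral_3_eq_3)
    have "(\<integral>\<^sup>+p\<^sub>4. indicator {p. val (snd p\<^sub>3) \<le> i \<and> val (snd p) = 0} p\<^sub>4 \<partial>measure_pmf (\<tau> (fst p\<^sub>3) (snd p\<^sub>3))) =
        emeasure (measure_pmf (\<tau> (fst p\<^sub>3) (snd p\<^sub>3))) (snd -` {s. val s = 0})"
      using True by (simp add: vimage_def)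
    also have "\<dots> = emeasure (measure_pmf (map_pmf snd (\<tau> (fst p\<^sub>3) (snd p\<^sub>3)))) {s. val s = 0}"
      by simp
    also have "map_pmf snd (\<tau> (fst p\<^sub>3) (snd p\<^sub>3)) = succ_pmf credit_mdp (snd p\<^sub>3)"
      using p3 mods by (intro rand[of _ "4 * n + 3"]) auto
    also have "emeasure \<dots> {s. val s = 0} = 1 - risk ?k (val (snd p\<^sub>3))"
      by (rule emeasure_accident(2)[OF p3(2)])
    finally show ?thesis using True by (simp add: failure_prob_def)
  qed (simp add: failure_prob_def)
  have "(\<integral>\<^sup>+p\<^sub>1. \<integral>\<^sup>+p\<^sub>2. \<integral>\<^sup>+p\<^sub>3. \<integral>\<^sup>+p\<^sub>4. indicator {p. val (snd p\<^sub>3) \<le> val (snd p\<^sub>1) \<and> val (snd p) = 0} p\<^sub>4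
      \<partial>measure_pmf (\<tau> (fst p\<^sub>3) (snd p\<^sub>3)) \<partial>measure_pmf (\<tau> (fst p\<^sub>2) (snd p\<^sub>2))
      \<partial>measure_pmf (\<tau> (fst p\<^sub>1) (snd p\<^sub>1)) \<partial>measure_pmf (\<tau> m s)) =
    (\<integral>\<^sup>+p\<^sub>1. \<integral>\<^sup>+p\<^sub>2. \<integral>\<^sup>+j. ennreal (1 - failure_prob ?k (val (snd p\<^sub>1)) j)
      \<partial>measure_pmf (?p (fst p\<^sub>2)) \<partial>measure_pmf (\<tau> (fst p\<^sub>1) (snd p\<^sub>1)) \<partial>measure_pmf (\<tau> m s))"
  proof (intro nn_integral_cong_AE, unfold AE_measure_pmf_iff, intro ballI,
      intro nn_integral_cong_AE, unfold AE_measure_pmf_iff, intro ballI)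
    fix p\<^sub>1 p\<^sub>2 assume p: "p\<^sub>1 \<in> set_pmf (\<tau> m s)" "p\<^sub>2 \<in> set_pmf (\<tau> (fst p\<^sub>1) (snd p\<^sub>1))"
    note p2 = S2[OF p]
    have "(\<integral>\<^sup>+p\<^sub>3. \<integral>\<^sup>+p\<^sub>4. indicator {p. val (snd p\<^sub>3) \<le> val (snd p\<^sub>1) \<and> val (snd p) = 0} p\<^sub>4
        \<partial>measure_pmf (\<tau> (fst p\<^sub>3) (snd p\<^sub>3)) \<partial>measure_pmf (\<tau> (fst p\<^sub>2) (snd p\<^sub>2))) =
      (\<integral>\<^sup>+p\<^sub>3. ennreal (1 - failure_prob ?k (val (snd p\<^sub>1)) (val (snd p\<^sub>3))) \<partial>measure_pmf (\<tau> (fst p\<^sub>2) (snd p\<^sub>2)))"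
      using p2 by (intro nn_integral_cong_AE, unfold AE_measure_pmf_iff, intro ballI last) auto
    also have "\<dots> = (\<integral>\<^sup>+j. ennreal (1 - failure_prob ?k (val (snd p\<^sub>1)) j) \<partial>measure_pmf (?p (fst p\<^sub>2)))"
      using p2 by simp
    finally show "(\<integral>\<^sup>+p\<^sub>3. \<integral>\<^sup>+p\<^sub>4. indicator {p. val (snd p\<^sub>3) \<le> val (snd p\<^sub>1) \<and> val (snd p) = 0} p\<^sub>4
        \<partial>measure_pmf (\<tau> (fst p\<^sub>3) (snd p\<^sub>3)) \<partial>measure_pmf (\<tau> (fst p\<^sub>2) (snd p\<^sub>2))) =
      (\<integral>\<^sup>+j. ennreal (1 - failure_prob ?k (val (snd p\<^sub>1)) j) \<partial>measure_pmf (?p (fst p\<^sub>2)))" .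
  qed
  also have "\<dots> = (\<integral>\<^sup>+x. \<integral>\<^sup>+j. ennreal (1 - failure_prob ?k (fst x) j) \<partial>measure_pmf (?p (snd x)) \<partial>measure_pmf ?J)"
    by simp
  also have "\<dots> \<le> ennreal (1 - 1 / (q * block_length ?k))"
  proof (rule no_failure_pigeonhole[where Q = "Q (4 * n + 2)"])
    have "map_pmf fst ?J = map_pmf val (map_pmf snd (\<tau> m s))"
      by (simp add: map_bind_pmf map_pmf_comp) (simp add: map_pmf_def)
    also have "map_pmf snd (\<tau> m s) = succ_pmf credit_mdp s"
      using m s mods by (intro rand[of _ "4 * n"]) auto
    also have "map_pmf val \<dots> = level_pmf ?k"
      using s mods by (simp add: map_pmf_comp val_pmf_def)
    finally show "map_pmf fst ?J = level_pmf ?k" .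
    show "snd ` set_pmf ?J \<subseteq> Q (4 * n + 2)"
      using S2 by auto
  qed (use Q q in auto)
  finally show ?thesis .
qed

section \<open>Survival over many gadgets\<close>

definition no_failures :: "nat \<Rightarrow> nat \<Rightarrow> (nat \<Rightarrow> nat) \<Rightarrow> bool" where
  "no_failures N n \<rho> \<longleftrightarrow> (\<forall>g. N \<le> g \<and> g < n \<longrightarrow> \<not> failure g \<rho>)"

lemma failure_cong: "(\<And>t. t \<le> 4 * n + 4 \<Longrightarrow> \<rho> t = \<rho>' t) \<Longrightarrow> failure n \<rho> = failure n \<rho>'"
  by (simp add: failure_def)

lemma no_failures_cong:
  "(\<And>t. t \<le> 4 * n \<Longrightarrow> \<rho> t = \<rho>' t) \<Longrightarrow> no_failures N n \<rho> = no_failures N n \<rho>'"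
  unfolding no_failures_def by (intro all_cong imp_cong refl arg_cong[where f = Not] failure_cong) auto

lemma nn_integral_memory_chain_Suc:
  "(\<integral>\<^sup>+w. f w \<partial>measure_pmf (memory_chain \<tau> m s (Suc n))) =
     (\<integral>\<^sup>+w. \<integral>\<^sup>+p. f (w @ [p]) \<partial>measure_pmf (\<tau> (fst (last w)) (snd (last w))) \<partial>measure_pmf (memory_chain \<tau> m s n))"
  by simp

text \<open>By the Markov property each further gadget contributes the factor of
  \<open>gadget_bound\<close>, whatever mode has been reached. From \<open>block_start q\<close> on,
  the levels outnumber the modes.\<close>

lemma memory_chain_no_failures:
  fixes Q :: "nat \<Rightarrow> 'm set"
  assumes \<tau>: "timed_update credit_mdp Q \<tau>" and Q: "\<And>n. finite (Q n)" "\<And>n. card (Q n) \<le> q"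
    and q: "0 < q" and m: "m\<^sub>0 \<in> Q 0" and N: "block_start q \<le> N"
  shows "N \<le> n \<Longrightarrow>
    emeasure (measure_pmf (memory_chain \<tau> m\<^sub>0 (state 0 0) (4 * n))) {w. no_failures N n (\<lambda>t. snd (w ! t))} \<le>
      ennreal (\<Prod>g\<in>{N..<n}. 1 - 1 / (q * block_length (level g)))"
proof (induction rule: dec_induct)
  case base
  then show ?case by (simp add: measure_pmf.emeasure_le_1)
next
  case (step n)
  let ?MC = "\<lambda>t. measure_pmf (memory_chain \<tau> m\<^sub>0 (state 0 0) t)"
  let ?A = "\<lambda>n. {w. no_failures N n (\<lambda>t. snd (w ! t))} :: ('m \<times> nat) list set"
  let ?c = "1 - 1 / (real q * block_length (level n))"
  let ?\<tau> = "\<lambda>p. measure_pmf (\<tau> (fst p) (snd p))"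
  have "q \<le> level n" using N step.hyps by (intro level_ge) simp
  have c: "0 \<le> ?c"
  proof -
    have "1 \<le> q * block_length (level n)" using q by (simp add: Suc_leI)
    then have "1 \<le> real q * block_length (level n)"
      by (metis of_nat_1 of_nat_le_iff of_nat_mult)
    then show ?thesis by simp
  qed
  have S: "4 * Suc n = Suc (Suc (Suc (Suc (4 * n))))" by simp
  have "emeasure (?MC (4 * Suc n)) (?A (Suc n)) = (\<integral>\<^sup>+w. indicator (?A (Suc n)) w \<partial>?MC (4 * Suc n))"
    by simp
  also have "\<dots> = (\<integral>\<^sup>+w. \<integral>\<^sup>+p\<^sub>1. \<integral>\<^sup>+p\<^sub>2. \<integral>\<^sup>+p\<^sub>3. \<integral>\<^sup>+p\<^sub>4. indicator (?A (Suc n)) (w @ [p\<^sub>1, p\<^sub>2, p\<^sub>3, p\<^sub>4])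
      \<partial>?\<tau> p\<^sub>3 \<partial>?\<tau> p\<^sub>2 \<partial>?\<tau> p\<^sub>1 \<partial>?\<tau> (last w) \<partial>?MC (4 * n))"
    unfolding S nn_integral_memory_chain_Suc by simp
  also have "\<dots> \<le> (\<integral>\<^sup>+w. ennreal ?c * indicator (?A n) w \<partial>?MC (4 * n))"
  proof (intro nn_integral_mono_AE, unfold AE_measure_pmf_iff, intro ballI)
    fix w assume w: "w \<in> set_pmf (memory_chain \<tau> m\<^sub>0 (state 0 0) (4 * n))"
    from memory_chain_support[OF wf_credit_mdp \<tau> m _ w]
    have len: "length w = Suc (4 * n)" and hd: "hd w = (m\<^sub>0, state 0 0)"
      and mode: "fst (last w) \<in> Q (4 * n)" and pr: "partial_run credit_mdp (map snd w)"
      by auto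
    have ne: "w \<noteq> []" using len by auto
    have t: "time (snd (last w)) = 4 * n"
      using partial_run_time[OF pr, of "4 * n"] len hd ne by (simp add: last_conv_nth hd_map)
    \<comment> \<open>The four new steps leave the earlier gadgets unchanged, so the past enters as
      a constant factor.\<close>
    have le: "indicator (?A (Suc n)) (w @ [p\<^sub>1, p\<^sub>2, p\<^sub>3, p\<^sub>4]) \<le>
        (indicator (?A n) w * indicator {p. val (snd p\<^sub>3) \<le> val (snd p\<^sub>1) \<and> val (snd p) = 0} p\<^sub>4 :: ennreal)"
      for p\<^sub>1 p\<^sub>2 p\<^sub>3 p\<^sub>4
    proof (cases "no_failures N (Suc n) (\<lambda>t. snd ((w @ [p\<^sub>1, p\<^sub>2, p\<^sub>3, p\<^sub>4]) ! t))")
      case True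
      let ?h = "\<lambda>t. snd ((w @ [p\<^sub>1, p\<^sub>2, p\<^sub>3, p\<^sub>4]) ! t)"
      have "no_failures N n ?h" using True by (simp add: no_failures_def)
      also have "no_failures N n ?h = no_failures N n (\<lambda>t. snd (w ! t))"
        using len by (intro no_failures_cong) (simp add: nth_append)
      finally have 1: "w \<in> ?A n" by simp
      have "\<not> failure n ?h" using True step.hyps by (simp add: no_failures_def)
      then have "val (snd p\<^sub>3) \<le> val (snd p\<^sub>1) \<and> val (snd p\<^sub>4) = 0"
        using len by (simp add: failure_def nth_append numeral_eq_Suc)
      with 1 show ?thesis by (simp add: indicator_def)
    qed simp
    have "(\<integral>\<^sup>+p\<^sub>1. \<integral>\<^sup>+p\<^sub>2. \<integral>\<^sup>+p\<^sub>3. \<integral>\<^sup>+p\<^sub>4. indicator (?A (Suc n)) (w @ [p\<^sub>1, p\<^sub>2, p\<^sub>3, p\<^sub>4])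
        \<partial>?\<tau> p\<^sub>3 \<partial>?\<tau> p\<^sub>2 \<partial>?\<tau> p\<^sub>1 \<partial>?\<tau> (last w)) \<le>
      (\<integral>\<^sup>+p\<^sub>1. \<integral>\<^sup>+p\<^sub>2. \<integral>\<^sup>+p\<^sub>3. \<integral>\<^sup>+p\<^sub>4. indicator (?A n) w *
          indicator {p. val (snd p\<^sub>3) \<le> val (snd p\<^sub>1) \<and> val (snd p) = 0} p\<^sub>4
        \<partial>?\<tau> p\<^sub>3 \<partial>?\<tau> p\<^sub>2 \<partial>?\<tau> p\<^sub>1 \<partial>?\<tau> (last w))"
      by (intro nn_integral_mono le)
    also have "\<dots> = indicator (?A n) w * (\<integral>\<^sup>+p\<^sub>1. \<integral>\<^sup>+p\<^sub>2. \<integral>\<^sup>+p\<^sub>3. \<integral>\<^sup>+p\<^sub>4.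
          indicator {p. val (snd p\<^sub>3) \<le> val (snd p\<^sub>1) \<and> val (snd p) = 0} p\<^sub>4
        \<partial>?\<tau> p\<^sub>3 \<partial>?\<tau> p\<^sub>2 \<partial>?\<tau> p\<^sub>1 \<partial>?\<tau> (last w))"
      by (simp add: nn_integral_cmult)
    also have "\<dots> \<le> indicator (?A n) w * ennreal ?c"
      using gadget_bound[OF \<tau> Q q \<open>q \<le> level n\<close> mode t] by (intro mult_left_mono) auto
    finally show "(\<integral>\<^sup>+p\<^sub>1. \<integral>\<^sup>+p\<^sub>2. \<integral>\<^sup>+p\<^sub>3. \<integral>\<^sup>+p\<^sub>4. indicator (?A (Suc n)) (w @ [p\<^sub>1, p\<^sub>2, p\<^sub>3, p\<^sub>4])
        \<partial>?\<tau> p\<^sub>3 \<partial>?\<tau> p\<^sub>2 \<partial>?\<tau> p\<^sub>1 \<partial>?\<tau> (last w)) \<le> ennreal ?c * indicator (?A n) w"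
      by (simp only: mult.commute)
  qed
  also have "\<dots> = ennreal ?c * emeasure (?MC (4 * n)) (?A n)"
    by (rule nn_integral_cmult_indicator) simp
  also have "\<dots> \<le> ennreal ?c * ennreal (\<Prod>g\<in>{N..<n}. 1 - 1 / (q * block_length (level g)))"
    by (intro mult_left_mono step.IH) simp
  also have "\<dots> = ennreal (\<Prod>g\<in>{N..<Suc n}. 1 - 1 / (q * block_length (level g)))"
    using c step.hyps by (simp add: ennreal_mult' mult.commute)
  finally show ?case .
qed

text \<open>By \<open>1 - x \<le> exp (- x)\<close> it suffices to sum the failure bounds. Block
  \<open>j\<close> consists of \<open>block_length j\<close> gadgets with bound
  \<open>1 / (q * block_length j)\<close> each and so contributes \<open>1 / q\<close>.\<close>

lemma prod_failure_bound:
  assumes "0 < q" "k \<le> l"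
  shows "(\<Prod>g\<in>{block_start k..<block_start l}. 1 - 1 / (real q * block_length (level g))) \<le>
    exp (- (real (l - k) / q))"
proof -
  let ?c = "\<lambda>g. 1 / (real q * block_length (level g))"
  have "(\<Prod>g\<in>{block_start k..<block_start l}. 1 - ?c g) \<le> (\<Prod>g\<in>{block_start k..<block_start l}. exp (- ?c g))"
  proof (intro prod_mono conjI)
    fix g
    have "1 \<le> q * block_length (level g)" using assms by (simp add: Suc_leI)
    then have "1 \<le> real q * block_length (level g)"
      by (metis of_nat_1 of_nat_le_iff of_nat_mult)
    then show "0 \<le> 1 - ?c g" by simp
    show "1 - ?c g \<le> exp (- ?c g)"
      using exp_ge_add_one_self[of "- ?c g"] by simp
  qed
  also have "\<dots> = exp (- (\<Sum>g\<in>{block_start k..<block_start l}. ?c g))"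
    by (simp add: exp_sum sum_negf[symmetric])
  also have "(\<Sum>g\<in>{block_start k..<block_start l}. ?c g) =
      (\<Sum>j\<in>{k..<l}. block_length j * (1 / (real q * block_length j)))"
    using assms(2) by (rule sum_level)
  also have "\<dots> = (\<Sum>j\<in>{k..<l}. 1 / real q)"
    by (intro sum.cong refl) simp
  also have "\<dots> = real (l - k) / q" by simp
  finally show ?thesis .
qed

text \<open>A winning run has no failure from some block \<open>k\<close> on. For fixed
  \<open>k\<close> the probability of surviving up to block \<open>l\<close> tends to
  \<open>0\<close>, so countably many null sets cover the winning runs.\<close>

lemma measure_bounded_memory:
  fixes Q :: "nat \<Rightarrow> 'm set"
  assumes \<tau>: "timed_update credit_mdp Q \<tau>" and Q: "\<And>n. finite (Q n)" "\<And>n. card (Q n) \<le> q"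
    and m: "m\<^sub>0 \<in> Q 0" and \<sigma>: "implements credit_mdp \<tau> m\<^sub>0 \<sigma>"
  shows "measure (run_measure credit_mdp (state 0 0) \<sigma>) (MP_liminf_nonneg credit_mdp (state 0 0)) = 0"
proof -
  let ?P = "run_measure credit_mdp (state 0 0) \<sigma>"
  have q: "0 < q" using m Q[of 0] card_gt_0_iff[of "Q 0"] by fastforce
  define A where "A k l = {\<rho>. map \<rho> [0..<Suc (4 * block_start l)] \<in>
    {h. no_failures (block_start k) (block_start l) ((!) h)}}" for k l
  have A: "A k l = {\<rho>. no_failures (block_start k) (block_start l) \<rho>}" for k l
  proof -
    have "no_failures N n ((!) (map \<rho> [0..<Suc (4 * n)])) = no_failures N n \<rho>" for N n \<rho>
      by (intro no_failures_cong) (simp only: nth_map_upt add_0 diff_zero less_Suc_eq_le)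
    then show ?thesis by (simp only: A_def mem_Collect_eq)
  qed
  have meas: "A k l \<in> sets ?P" for k l
    unfolding A_def by (rule prefix_event_in_sets)
  have bound: "emeasure ?P (A k l) \<le> ennreal (exp (- (real (l - k) / q)))" if "q \<le> k" "k \<le> l" for k l
  proof -
    let ?N = "block_start k" and ?n = "block_start l"
    let ?B = "{h. no_failures ?N ?n ((!) h)}"
    let ?MC = "memory_chain \<tau> m\<^sub>0 (state 0 0) (4 * ?n)"
    have "emeasure ?P (A k l) = emeasure (measure_pmf (map_pmf (map snd) ?MC)) ?B"
      unfolding A_def emeasure_run_measure_prefix
      by (subst hist_pmf_eq_memory_chain[OF wf_credit_mdp \<tau> m _ \<sigma>]) simp_all
    also have "\<dots> = emeasure (measure_pmf ?MC) (map snd -` ?B)" by simp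
    also have "\<dots> = emeasure (measure_pmf ?MC) {w. no_failures ?N ?n (\<lambda>t. snd (w ! t))}"
    proof (rule emeasure_eq_AE)
      show "AE w in measure_pmf ?MC. (w \<in> map snd -` ?B) = (w \<in> {w. no_failures ?N ?n (\<lambda>t. snd (w ! t))})"
        unfolding AE_measure_pmf_iff
      proof
        fix w assume "w \<in> set_pmf ?MC"
        then have "length w = Suc (4 * ?n)"
          using memory_chain_support[OF wf_credit_mdp \<tau> m] by simp
        then have "no_failures ?N ?n ((!) (map snd w)) = no_failures ?N ?n (\<lambda>t. snd (w ! t))"
          by (intro no_failures_cong) simp
        then show "(w \<in> map snd -` ?B) = (w \<in> {w. no_failures ?N ?n (\<lambda>t. snd (w ! t))})"
          by simp
      qed
    qed simp_all
    also have "\<dots> \<le> ennreal (\<Prod>g\<in>{?N..<?n}. 1 - 1 / (q * block_length (level g)))"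
      using that by (intro memory_chain_no_failures[OF \<tau> Q q m] block_start_mono)
    also have "\<dots> \<le> ennreal (exp (- (real (l - k) / q)))"
      using prod_failure_bound[OF q that(2)] by (intro ennreal_leI) simp
    finally show ?thesis .
  qed
  have null: "(\<Inter>l. A k l) \<in> null_sets ?P" if "q \<le> k" for k
  proof (rule null_setsI)
    show "(\<Inter>l. A k l) \<in> sets ?P" using meas by (intro sets.countable_INT) auto
    have "emeasure ?P (\<Inter>l. A k l) \<le> ennreal (exp (- (real n / q)))" for n
    proof -
      have "emeasure ?P (\<Inter>l. A k l) \<le> emeasure ?P (A k (k + n))"
        by (intro emeasure_mono meas) auto
      also have "\<dots> \<le> ennreal (exp (- (real n / q)))"
        using bound[OF that, of "k + n"] by simp
      finally show ?thesis .
    qed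
    moreover have "(\<lambda>n. ennreal (exp (- (real n / q)))) \<longlonglongrightarrow> ennreal 0"
      using q by (intro tendsto_ennrealI) real_asymp
    ultimately have "emeasure ?P (\<Inter>l. A k l) \<le> ennreal 0"
      by (intro LIMSEQ_le_const) auto
    then show "emeasure ?P (\<Inter>l. A k l) = 0" by simp
  qed
  have "MP_liminf_nonneg credit_mdp (state 0 0) \<subseteq> (\<Union>k\<in>{q..}. \<Inter>l. A k l)"
  proof
    fix \<rho> assume "\<rho> \<in> MP_liminf_nonneg credit_mdp (state 0 0)"
    from MP_liminf_nonneg_imp_finite_failures[OF this]
    obtain N where N: "\<And>n. N \<le> n \<Longrightarrow> \<not> failure n \<rho>" by blast
    \<comment> \<open>The maximum starts beyond all failures and where the levels outnumber the
      modes.\<close>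
    have "N \<le> block_start (max q N)"
      using block_start_ge[of "max q N"] by simp
    then have "\<rho> \<in> (\<Inter>l. A (max q N) l)"
      using N by (auto simp: A no_failures_def)
    then show "\<rho> \<in> (\<Union>k\<in>{q..}. \<Inter>l. A k l)" by (intro UN_I[of "max q N"]) auto
  qed
  moreover have "(\<Union>k\<in>{q..}. \<Inter>l. A k l) \<in> null_sets ?P"
    using null by (intro null_sets_UN') auto
  ultimately have "MP_liminf_nonneg credit_mdp (state 0 0) \<in> null_sets ?P"
    by (intro null_sets_subset[OF _ MP_liminf_nonneg_in_sets])
  then show ?thesis by (simp add: null_sets_def measure_def)
qed

section \<open>Finite-memory and Markov strategies as instances\<close>

lemma measure_FR_strategy:
  assumes "FR_strategy credit_mdp \<sigma>"
  shows "measure (run_measure credit_mdp (state 0 0) \<sigma>) (MP_liminf_nonneg credit_mdp (state 0 0)) = 0"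
proof -
  from assms obtain Q :: "nat set" and m\<^sub>0 \<tau> where Q: "finite Q" "m\<^sub>0 \<in> Q"
    and \<tau>: "memory_update credit_mdp Q \<tau>" and \<sigma>: "implements credit_mdp \<tau> m\<^sub>0 \<sigma>"
    unfolding FR_strategy_def by blast
  have "timed_update credit_mdp (\<lambda>_. Q) \<tau>"
    using \<tau> unfolding timed_update_def memory_update_def by blast
  then show ?thesis
    using Q \<sigma> by (intro measure_bounded_memory[where Q = "\<lambda>_. Q" and q = "card Q"]) simp_all
qed

text \<open>The mode set is infinite, but at step \<open>n\<close> the counter equals
  \<open>n\<close>, so only as many modes are available as there are bit lists of length
  \<open>k\<close>.\<close>

lemma measure_kbit_Markov_strategy:
  assumes "kbit_Markov_strategy k credit_mdp \<sigma>"
  shows "measure (run_measure credit_mdp (state 0 0) \<sigma>) (MP_liminf_nonneg credit_mdp (state 0 0)) = 0"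
proof -
  from assms obtain bs\<^sub>0 \<tau> where bs: "length bs\<^sub>0 = k" and \<tau>: "memory_update credit_mdp (kbit_modes k) \<tau>"
    and count: "\<forall>n bs. \<forall>s\<in>states credit_mdp. length bs = k \<longrightarrow>
      (\<forall>((n', bs'), s')\<in>set_pmf (\<tau> (n, bs) s). n' = Suc n)"
    and \<sigma>: "implements credit_mdp \<tau> (0, bs\<^sub>0) \<sigma>"
    unfolding kbit_Markov_strategy_def by blast
  let ?L = "{bs :: bool list. length bs = k}"
  let ?Q = "\<lambda>n :: nat. {n} \<times> ?L"
  have fin: "finite ?L" using finite_lists_length_eq[of "UNIV :: bool set" k] by simp
  have "timed_update credit_mdp ?Q \<tau>"
    unfolding timed_update_def
  proof (intro conjI allI ballI)
    fix n m s assume m: "m \<in> ?Q n"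
    then obtain bs where mb: "m = (n, bs)" "length bs = k" by auto
    then have mk: "m \<in> kbit_modes k" by (simp add: kbit_modes_def)
    have Q: "fst p \<in> ?Q (Suc n)" if "p \<in> set_pmf (\<tau> m s)" "fst p \<in> kbit_modes k" for p
    proof -
      obtain n' bs' s' where p: "p = ((n', bs'), s')" by (metis prod.collapse)
      have step: "\<forall>((n', bs'), s')\<in>set_pmf (\<tau> (n, bs) s). n' = Suc n"
        using count[THEN spec[of _ n], THEN spec[of _ bs], THEN bspec[of _ _ s]] mb(2) by simp
      have "n' = Suc n"
        using bspec[OF step that(1)[unfolded mb(1)]] by (simp add: p)
      with that(2) show ?thesis by (simp add: p kbit_modes_def)
    qed
    show "set_pmf (\<tau> m s) \<subseteq> ?Q (Suc n) \<times> succs credit_mdp s" if "s \<in> ctrl credit_mdp"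
    proof
      fix p assume p: "p \<in> set_pmf (\<tau> m s)"
      then have "p \<in> kbit_modes k \<times> succs credit_mdp s"
        using \<tau> mk that unfolding memory_update_def by blast
      then show "p \<in> ?Q (Suc n) \<times> succs credit_mdp s"
        using Q[OF p] by (simp add: mem_Times_iff)
    qed
    assume "s \<in> rand credit_mdp"
    then have r: "fst ` set_pmf (\<tau> m s) \<subseteq> kbit_modes k" "map_pmf snd (\<tau> m s) = succ_pmf credit_mdp s"
      using \<tau> mk unfolding memory_update_def by blast+
    show "map_pmf snd (\<tau> m s) = succ_pmf credit_mdp s" by (fact r(2))
    show "fst ` set_pmf (\<tau> m s) \<subseteq> ?Q (Suc n)"
      using Q r(1) by blast
  qed
  then show ?thesis
    using \<sigma> fin bs
    by (intro measure_bounded_memory[where Q = ?Q and q = "card ?L"]) (simp_all add: card_cartesian_product_singleton)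
qed

theorem theorem4p20:
  shows "\<exists>(M :: nat mdp) s\<^sub>0.
    wf_mdp M \<and> finitely_branching M \<and> acyclic (transitions M) \<and> integer_rewards M \<and>
    s\<^sub>0 \<in> states M \<and> step_counter_implicit M s\<^sub>0 \<and>
    (\<exists>\<sigma>. strategy M \<sigma> \<and> measure (run_measure M s\<^sub>0 \<sigma>) (MP_liminf_nonneg M s\<^sub>0) = 1) \<and>
    (\<forall>\<sigma>. FR_strategy M \<sigma> \<longrightarrow> measure (run_measure M s\<^sub>0 \<sigma>) (MP_liminf_nonneg M s\<^sub>0) = 0) \<and>
    (\<forall>k \<sigma>. kbit_Markov_strategy k M \<sigma> \<longrightarrow>
       measure (run_measure M s\<^sub>0 \<sigma>) (MP_liminf_nonneg M s\<^sub>0) \<noteq> 1)"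
proof (intro exI[of _ credit_mdp] exI[of _ "state 0 0"] conjI)
  show "\<exists>\<sigma>. strategy credit_mdp \<sigma> \<and>
      measure (run_measure credit_mdp (state 0 0) \<sigma>) (MP_liminf_nonneg credit_mdp (state 0 0)) = 1"
    using strategy_match_strategy measure_match_strategy by blast
  show "\<forall>k \<sigma>. kbit_Markov_strategy k credit_mdp \<sigma> \<longrightarrow>
      measure (run_measure credit_mdp (state 0 0) \<sigma>) (MP_liminf_nonneg credit_mdp (state 0 0)) \<noteq> 1"
    by (simp add: measure_kbit_Markov_strategy)
qed (simp_all add: wf_credit_mdp finitely_branching_credit_mdp acyclic_credit_mdp
    integer_rewards_credit_mdp step_counter_implicit_credit_mdp measure_FR_strategy)

end
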